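(* Let $p\ge31$ be a prime, and let $f\colon\mathbb F_p^2\to\mathbb C$ be a nonzero function. Write $S:=\operatorname{supp} f\subseteq\mathbb F_p^2$ and $X:=\operatorname{supp}\hat f\subseteq\widehat{\mathbb F_p^2}$. Then for any real $\varepsilon\in(0,1)$ we have either $$\min\{|S|,|X|\}\ge2(1-\varepsilon)p$$ or $$\max\{|S|,|X|\}\ge\varepsilon p^{3/2},$$ except if the smallest of the sets $S$ and $X$ is contained in a coset of a nonzero, proper subgroup of the corresponding group.
   Context: $\mathbb F_p^2$ is regarded as an additive group $G$; $\widehat G$ is its group of complex characters. For $f\colon G\to\mathbb C$, the Fourier transform $\hat f\colon\widehat G\to\mathbb C$ is $\hat f(\chi)=\frac1{|G|}\sum_{g\in G}f(g)\overline{\chi(g)}$. The corresponding group is $\mathbb F_p^2$ for $S$ and $\widehat{\mathbb F_p^2}$ for $X$. The support $\operatorname{supp}$ of a function is the set of points where it is nonzero. *)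

theory Defs
  imports
    Complex_Main
    "HOL-Library.Product_Plus"
    "HOL-Algebra.Coset"
    "Berlekamp_Zassenhaus.Finite_Field"
begin

definition additive_group :: "'g::ab_group_add monoid" where
  "additive_group = \<lparr>carrier = UNIV, monoid.mult = (+), one = 0\<rparr>"

text \<open>Over a finite group every homomorphism into the nonzero complex numbers takes values
  on the unit circle, so no condition on the absolute value is imposed.\<close>

definition characters :: "('g::{finite,ab_group_add} \<Rightarrow> complex) set" where
  "characters = {\<chi>. (\<forall>x. \<chi> x \<noteq> 0) \<and> (\<forall>x y. \<chi> (x + y) = \<chi> x * \<chi> y)}"

definition dual_group :: "('g::{finite,ab_group_add} \<Rightarrow> complex) monoid" where
  "dual_group = \<lparr>carrier = characters, monoid.mult = (\<lambda>\<chi> \<psi> x. \<chi> x * \<psi> x), one = (\<lambda>_. 1)\<rparr>"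

text \<open>Only the values at elements of the set of characters are meaningful.\<close>

definition fourier :: "('g::{finite,ab_group_add} \<Rightarrow> complex) \<Rightarrow> ('g \<Rightarrow> complex) \<Rightarrow> complex" where
  "fourier f \<chi> = 1 / of_nat CARD('g) * (\<Sum>g\<in>UNIV. f g * cnj (\<chi> g))"

definition supp_on :: "'a set \<Rightarrow> ('a \<Rightarrow> complex) \<Rightarrow> 'a set" where
  "supp_on A f = {x \<in> A. f x \<noteq> 0}"

definition in_proper_coset :: "('a, 'b) monoid_scheme \<Rightarrow> 'a set \<Rightarrow> bool" where
  "in_proper_coset G A \<longleftrightarrow>
    (\<exists>H. subgroup H G \<and> H \<noteq> {one G} \<and> H \<noteq> carrier G \<and> (\<exists>C \<in> RCOSETS G H. A \<subseteq> C))"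

lemma comm_group_additive_group: "comm_group (additive_group :: 'g::ab_group_add monoid)"
proof (rule comm_groupI)
  fix x :: 'g
  show "\<exists>y\<in>carrier additive_group. y \<otimes>\<^bsub>additive_group\<^esub> x = \<one>\<^bsub>additive_group\<^esub>"
    by (rule bexI[of _ "- x"]) (simp_all add: additive_group_def)
qed (simp_all add: additive_group_def algebra_simps)

lemma comm_group_dual_group:
  "comm_group (dual_group :: ('g::{finite,ab_group_add} \<Rightarrow> complex) monoid)"
proof (rule comm_groupI)
  fix \<chi> :: "'g \<Rightarrow> complex"
  assume "\<chi> \<in> carrier dual_group"
  then show "\<exists>\<psi>\<in>carrier dual_group. \<psi> \<otimes>\<^bsub>dual_group\<^esub> \<chi> = \<one>\<^bsub>dual_group\<^esub>"
    by (intro bexI[of _ "\<lambda>x. inverse (\<chi> x)"]) (auto simp: dual_group_def characters_def)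
qed (auto simp: dual_group_def characters_def algebra_simps)

end

theory Submission
  imports Defs
begin

text \<open>Write \<open>p\<close> for the order of the field and \<open>\<zeta>\<close> for a primitive \<open>p\<close>-th root of unity. The characters
  of the plane are the functions \<open>x \<mapsto> \<zeta> ^ (u \<bullet> x)\<close> for points \<open>u\<close> of the plane, so the Fourier transform
  may be regarded as a function on the plane itself.

  The argument rests on the proposition \<open>rich_line_in_support\<close>: if \<open>q \<le> p - 2\<close>, the transform of
  \<open>f \<noteq> 0\<close> has fewer than \<open>p (p - q)\<close> nonzero values, and \<open>f\<close> has at most \<open>2 q + 1\<close> nonzero values, then
  some line contains at least \<open>q + 2\<close> points of the support of \<open>f\<close>. Its proof extends to
  the plane the proof of Chebotarev's theorem on minors of Fourier matrices of prime order, which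
  exploits that all characters become trivial modulo \<open>\<zeta> - 1\<close>.
  The transform has more than \<open>p q\<close> zeros, so these zeros admit weights with arbitrary
  prescribed moments of order at most \<open>q\<close> (\<open>exists_weights_monomials\<close>). Suitably weighted sums of the
  relations at these zeros are divisible by powers of \<open>\<zeta> - 1\<close>, and after division one obtains, for each
  polynomial \<open>Q\<close> of degree at most \<open>q\<close>, a relation \<open>(\<Sum>x. f x * v x) = 0\<close> with coefficients in
  \<open>\<int>[\<zeta>]\<close> that reduce to the values \<open>Q x\<close> modulo \<open>\<zeta> - 1\<close> (\<open>poly_fun_realizable\<close>). If no line contained
  \<open>q + 2\<close> points of the support, then every point \<open>z\<close> of every subset of the support could be
  separated from the at most \<open>2 q\<close> other points by such a \<open>Q\<close>: a product of \<open>q\<close> linear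
  factors, each chosen to vanish at one or two of these points but not at \<open>z\<close>
  (\<open>cover_by_lines_avoiding_point\<close>). The relations would then form a triangular system modulo
  \<open>\<zeta> - 1\<close>, forcing \<open>f = 0\<close> (\<open>vanishing_by_isolation\<close>).

  For the theorem, let \<open>n \<le> m\<close> be the sizes of the two supports, the smaller one being that of \<open>f\<close>, and
  let \<open>k\<close> be the integer part of \<open>m / p\<close>. If both inequalities fail, then \<open>n + 11 k < 2 p\<close>. The
  proposition rules out \<open>m < p\<close>, and otherwise yields, with \<open>q = p - 1 - k\<close>, a line with at least
  \<open>p + 1 - k\<close> points of the support. Were some point of the support off this line, then
  multiplying \<open>f\<close> by a character minus a constant would remove exactly the points on the line while at most
  doubling the support of the transform; the proposition with \<open>q = p - 2 - 2 k\<close> would give another \<open>p - 2 k\<close>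
  points, in contradiction to the bound on \<open>n\<close>. If the transform has the smaller support, the same argument
  applies to it, by Fourier inversion.\<close>

section \<open>Weights with prescribed moments\<close>

text \<open>Dually, a polynomial of degree at most \<open>q\<close> with more than \<open>q\<close> zeros vanishes. The induction
  peels off one point \<open>\<beta>\<^sub>0\<close>, which corresponds to splitting off the factor \<open>\<beta> - \<beta>\<^sub>0\<close>.\<close>

lemma exists_weights_powers:
  fixes B :: "'a::field set"
  assumes "finite B" and "q < card B"
  shows "\<exists>c. \<forall>b\<le>q. (\<Sum>\<beta>\<in>B. c \<beta> * \<beta> ^ b) = \<tau> b"
  using assms
proof (induction q arbitrary: B \<tau>)
  case 0
  then obtain \<beta>0 where "\<beta>0 \<in> B"
    by (metis card_gt_0_iff ex_in_conv)
  then show ?case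
    using 0 by (intro exI[of _ "\<lambda>\<beta>. if \<beta> = \<beta>0 then \<tau> 0 else 0"]) (simp add: sum.delta)
next
  case (Suc q)
  then obtain \<beta>0 where b0: "\<beta>0 \<in> B"
    by (metis card_gt_0_iff ex_in_conv less_nat_zero_code not_gr_zero)
  define B' where "B' = B - {\<beta>0}"
  have B': "finite B'" "q < card B'"
    using Suc.prems b0 by (auto simp: B'_def)
  from Suc.IH[OF this, of "\<lambda>b. \<tau> (Suc b) - \<beta>0 * \<tau> b"] obtain c' where
    c': "\<And>b. b \<le> q \<Longrightarrow> (\<Sum>\<beta>\<in>B'. c' \<beta> * \<beta> ^ b) = \<tau> (Suc b) - \<beta>0 * \<tau> b" by blast
  define c where "c \<beta> = (if \<beta> = \<beta>0 then \<tau> 0 - (\<Sum>\<gamma>\<in>B'. c' \<gamma> / (\<gamma> - \<beta>0)) else c' \<beta> / (\<beta> - \<beta>0))"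
    for \<beta>
  have split: "(\<Sum>\<beta>\<in>B. c \<beta> * g \<beta>) = c \<beta>0 * g \<beta>0 + (\<Sum>\<beta>\<in>B'. c' \<beta> / (\<beta> - \<beta>0) * g \<beta>)" for g
  proof -
    have "(\<Sum>\<beta>\<in>B'. c \<beta> * g \<beta>) = (\<Sum>\<beta>\<in>B'. c' \<beta> / (\<beta> - \<beta>0) * g \<beta>)"
      by (intro sum.cong) (auto simp: c_def B'_def)
    then show ?thesis
      unfolding B'_def using Suc.prems(1) b0 by (simp add: sum.remove[of B \<beta>0])
  qed
  have "(\<Sum>\<beta>\<in>B. c \<beta> * \<beta> ^ b) = \<tau> b" if "b \<le> Suc q" for b
    using that
  proof (induction b)
    case 0
    show ?case using split[of "\<lambda>_. 1"] by (simp add: c_def)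
  next
    case (Suc b)
    have "(\<Sum>\<beta>\<in>B. c \<beta> * \<beta> ^ Suc b) - \<beta>0 * (\<Sum>\<beta>\<in>B. c \<beta> * \<beta> ^ b)
        = (\<Sum>\<beta>\<in>B. c \<beta> * ((\<beta> - \<beta>0) * \<beta> ^ b))"
      by (simp add: sum_distrib_left sum_subtractf algebra_simps)
    also have "\<dots> = (\<Sum>\<beta>\<in>B'. c' \<beta> * \<beta> ^ b)"
      unfolding split by (auto simp: B'_def intro!: sum.cong)
    finally show ?case using c'[of b] Suc by simp
  qed
  then show ?case by blast
qed

text \<open>With \<open>p\<close> the order of the field, more than \<open>p q\<close> points of the plane carry weights with
  arbitrary prescribed moments for all monomials of total degree at most \<open>q\<close>. By
  pigeonhole some vertical line contains more than \<open>q\<close> of the points;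
  the one-dimensional lemma handles that line, and removing it costs at most \<open>p\<close> points and lowers
  the degree by one.\<close>

lemma exists_weights_monomials:
  fixes Z :: "('a::{field,finite} \<times> 'a) set"
  assumes "CARD('a) * q < card Z"
  shows "\<exists>c. \<forall>a b. a + b \<le> q \<longrightarrow> (\<Sum>u\<in>Z. c u * (fst u ^ a * snd u ^ b)) = \<tau> a b"
  using assms
proof (induction q arbitrary: Z \<tau>)
  case 0
  then obtain u0 where "u0 \<in> Z"
    by (metis card_gt_0_iff ex_in_conv mult_0_right)
  then show ?case
    by (intro exI[of _ "\<lambda>u. if u = u0 then \<tau> 0 0 else 0"]) (simp add: sum.delta)
next
  case (Suc q)
  define col where "col \<alpha> = {u \<in> Z. fst u = \<alpha>}" for \<alpha>
  have "\<exists>\<alpha>. Suc q < card (col \<alpha>)"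
  proof (rule ccontr)
    assume "\<not> ?thesis"
    then have "(\<Sum>\<alpha>\<in>UNIV. card (col \<alpha>)) \<le> (\<Sum>\<alpha>\<in>(UNIV::'a set). Suc q)"
      by (intro sum_mono) (simp add: not_less)
    moreover have "(\<Sum>\<alpha>\<in>UNIV. card (col \<alpha>)) = card Z"
    proof -
      have "card (\<Union>\<alpha>. col \<alpha>) = (\<Sum>\<alpha>\<in>UNIV. card (col \<alpha>))"
        by (intro card_UN_disjoint) (auto simp: col_def)
      moreover have "(\<Union>\<alpha>. col \<alpha>) = Z" by (auto simp: col_def)
      ultimately show ?thesis by simp
    qed
    ultimately show False using Suc.prems by simp
  qed
  then obtain \<alpha> where \<alpha>: "Suc q < card (col \<alpha>)" by blast
  define Z' where "Z' = Z - col \<alpha>"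
  have inj: "inj_on snd (col \<alpha>)" by (auto simp: inj_on_def col_def prod_eq_iff)
  have card_col: "card (col \<alpha>) = card (snd ` col \<alpha>)"
    using card_image[OF inj] by simp
  have "card Z = card Z' + card (col \<alpha>)"
    unfolding Z'_def by (subst card_Diff_subset) (auto simp: col_def card_mono)
  moreover have "card (col \<alpha>) \<le> CARD('a)"
    unfolding card_col by (simp add: card_mono)
  ultimately have "CARD('a) * q < card Z'" using Suc.prems by simp
  from Suc.IH[OF this, of "\<lambda>a b. \<tau> (Suc a) b - \<alpha> * \<tau> a b"] obtain c' where
    c': "\<And>a b. a + b \<le> q \<Longrightarrow>
      (\<Sum>u\<in>Z'. c' u * (fst u ^ a * snd u ^ b)) = \<tau> (Suc a) b - \<alpha> * \<tau> a b" by blast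
  obtain d where d: "\<And>b. b \<le> Suc q \<Longrightarrow> (\<Sum>\<beta>\<in>snd ` col \<alpha>. d \<beta> * \<beta> ^ b)
      = \<tau> 0 b - (\<Sum>u\<in>Z'. c' u / (fst u - \<alpha>) * snd u ^ b)"
    using exists_weights_powers[of "snd ` col \<alpha>" "Suc q"
        "\<lambda>b. \<tau> 0 b - (\<Sum>u\<in>Z'. c' u / (fst u - \<alpha>) * snd u ^ b)"] \<alpha> card_col by auto
  define c where "c u = (if fst u = \<alpha> then d (snd u) else c' u / (fst u - \<alpha>))" for u
  have split: "(\<Sum>u\<in>Z. c u * g u)
      = (\<Sum>\<beta>\<in>snd ` col \<alpha>. d \<beta> * g (\<alpha>, \<beta>)) + (\<Sum>u\<in>Z'. c' u / (fst u - \<alpha>) * g u)" for g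
  proof -
    have "(\<Sum>u\<in>Z. c u * g u) = (\<Sum>u\<in>col \<alpha>. c u * g u) + (\<Sum>u\<in>Z'. c u * g u)"
      unfolding Z'_def by (subst sum.subset_diff[of "col \<alpha>"]) (auto simp: col_def)
    also have "(\<Sum>u\<in>col \<alpha>. c u * g u) = (\<Sum>\<beta>\<in>snd ` col \<alpha>. d \<beta> * g (\<alpha>, \<beta>))"
      unfolding sum.reindex[OF inj] by (intro sum.cong) (auto simp: col_def c_def)
    also have "(\<Sum>u\<in>Z'. c u * g u) = (\<Sum>u\<in>Z'. c' u / (fst u - \<alpha>) * g u)"
      by (intro sum.cong) (auto simp: col_def c_def Z'_def)
    finally show ?thesis .
  qed
  have "(\<Sum>u\<in>Z. c u * (fst u ^ a * snd u ^ b)) = \<tau> a b" if "a + b \<le> Suc q" for a b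
    using that
  proof (induction a)
    case 0
    then show ?case using split[of "\<lambda>u. snd u ^ b"] d[of b] by simp
  next
    case (Suc a)
    have "(\<Sum>u\<in>Z. c u * (fst u ^ Suc a * snd u ^ b)) - \<alpha> * (\<Sum>u\<in>Z. c u * (fst u ^ a * snd u ^ b))
        = (\<Sum>u\<in>Z. c u * ((fst u - \<alpha>) * (fst u ^ a * snd u ^ b)))"
      by (simp add: sum_distrib_left sum_subtractf algebra_simps)
    also have "\<dots> = (\<Sum>u\<in>Z'. c' u * (fst u ^ a * snd u ^ b))"
      unfolding split by (auto simp: Z'_def col_def intro!: sum.cong)
    finally show ?case using c'[of a b] Suc by simp
  qed
  then show ?case by blast
qed

section \<open>Reduction of integer polynomials at roots of unity\<close>

text \<open>Evaluation of integer polynomials at a complex number \<open>\<zeta>\<close>. For a \<open>p\<close>-th root of unity \<open>\<zeta>\<close> its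
  image is \<open>\<int>[\<zeta>]\<close>; elements of this ring are represented throughout by integer polynomials.\<close>

definition ev_root :: "complex \<Rightarrow> int poly \<Rightarrow> complex" where
  "ev_root \<zeta> h = poly (of_int_poly h) \<zeta>"

text \<open>Evaluation at \<open>1\<close> modulo \<open>p\<close>, which is reduction modulo \<open>\<zeta> - 1\<close> on representatives.\<close>

definition red :: "int poly \<Rightarrow> 'p::prime_card mod_ring" where
  "red h = of_int (poly h 1)"

lemma comm_ring_hom_ev_root: "comm_ring_hom (ev_root \<zeta>)"
  by unfold_locales (simp_all add: ev_root_def hom_distribs)

lemma comm_ring_hom_red: "comm_ring_hom (red :: int poly \<Rightarrow> 'p::prime_card mod_ring)"
  by unfold_locales (simp_all add: red_def)

lemma ev_root_simps [simp]:
  "ev_root \<zeta> 0 = 0" "ev_root \<zeta> 1 = 1" "ev_root \<zeta> (g + h) = ev_root \<zeta> g + ev_root \<zeta> h"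
  "ev_root \<zeta> (g - h) = ev_root \<zeta> g - ev_root \<zeta> h" "ev_root \<zeta> (g * h) = ev_root \<zeta> g * ev_root \<zeta> h"
  "ev_root \<zeta> (g ^ n) = ev_root \<zeta> g ^ n" "ev_root \<zeta> (Polynomial.smult c h) = of_int c * ev_root \<zeta> h"
  "ev_root \<zeta> [:-1, 1:] = \<zeta> - 1" "ev_root \<zeta> (Polynomial.monom 1 n) = \<zeta> ^ n"
  by (simp_all add: ev_root_def hom_distribs poly_monom)

lemma red_simps [simp]:
  "red 0 = 0" "red 1 = 1" "red (g + h) = red g + red h"
  "red (g - h) = red g - red h" "red (g * h) = red g * red h"
  "red (g ^ n) = red g ^ n" "red (Polynomial.smult c h) = of_int c * red h"
  "red [:-1, 1:] = 0"
  by (simp_all add: red_def)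

lemma ev_root_sum: "ev_root \<zeta> (sum g A) = (\<Sum>x\<in>A. ev_root \<zeta> (g x))"
  by (induction A rule: infinite_finite_induct) auto

lemma of_int_mod_ring_eq_0_iff:
  "of_int c = (0 :: 'p::prime_card mod_ring) \<longleftrightarrow> int CARD('p) dvd c"
  using of_int_eq_0_iff_char_dvd[where ?'a = "'p mod_ring"] by simp

lemma red_eq_poly: "red h = poly (of_int_poly h) (1 :: 'p::prime_card mod_ring)"
proof -
  have "poly (of_int_poly h) (of_int 1 :: 'p mod_ring) = of_int (poly h 1)"
    by (rule of_int_hom.poly_map_poly)
  then show ?thesis by (simp add: red_def)
qed

lemma of_int_poly_eq_0_imp_smult:
  assumes "of_int_poly P = (0 :: 'p::prime_card mod_ring poly)"
  obtains Q where "P = Polynomial.smult (int CARD('p)) Q"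
proof
  have "int CARD('p) dvd coeff P n" for n
  proof -
    have "coeff (of_int_poly P :: 'p mod_ring poly) n = 0" using assms by simp
    then show ?thesis by (simp add: coeff_map_poly of_int_mod_ring_eq_0_iff)
  qed
  then show "P = Polynomial.smult (int CARD('p)) (map_poly (\<lambda>c. c div int CARD('p)) P)"
    by (intro poly_eqI) (simp add: coeff_map_poly)
qed

lemma linear_power_card:
  "[:-1, 1:] ^ CARD('p) = (Polynomial.monom 1 CARD('p) - 1 :: 'p::prime_card mod_ring poly)"
proof -
  have "CHAR('p mod_ring poly) = CARD('p)" by simp
  then have pr: "prime CHAR('p mod_ring poly)" using prime_card[where ?'a = 'p] by simp
  have "(([:0, 1:] - 1) + 1 :: 'p mod_ring poly) ^ CARD('p) = ([:0, 1:] - 1) ^ CARD('p) + 1 ^ CARD('p)"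
    by (rule freshmans_dream[OF pr]) simp
  moreover have "[:0, 1:] - 1 = ([:-1, 1:] :: 'p mod_ring poly)"
    by (simp add: one_pCons)
  moreover have "[:0, 1:] ^ CARD('p) = (Polynomial.monom 1 CARD('p) :: 'p mod_ring poly)"
    by (simp add: monom_altdef)
  ultimately show ?thesis by (simp add: algebra_simps)
qed

text \<open>Reduction modulo \<open>\<zeta> - 1\<close> is well defined on \<open>\<int>[\<zeta>]\<close>. A primitive integer polynomial \<open>g\<close> of
  least degree with root \<open>\<zeta>\<close> divides every integer polynomial with root \<open>\<zeta>\<close>, in particular
  \<open>X ^ p - 1\<close>, which is \<open>(X - 1) ^ p\<close> modulo \<open>p\<close>; so \<open>g\<close> vanishes at \<open>1\<close> modulo \<open>p\<close>.\<close>

lemma red_eq_0_of_ev_root_eq_0: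
  assumes "\<zeta> ^ CARD('p) = 1" and "ev_root \<zeta> h = 0"
  shows "red h = (0 :: 'p::prime_card mod_ring)"
proof -
  define n where "n = CARD('p)"
  have n: "n > 0" by (simp add: n_def)
  have ev_cyc: "ev_root \<zeta> (Polynomial.monom 1 n - 1) = 0" using assms(1) by (simp add: n_def)
  have cyc: "Polynomial.monom 1 n - 1 \<noteq> (0 :: int poly)"
  proof
    assume "Polynomial.monom 1 n - 1 = (0 :: int poly)"
    then have "coeff (Polynomial.monom 1 n - 1 :: int poly) n = 0" by simp
    then show False using n by simp
  qed
  define good where "good g \<longleftrightarrow> g \<noteq> 0 \<and> ev_root \<zeta> g = 0" for g :: "int poly"
  have "good (Polynomial.monom 1 n - 1)" using cyc ev_cyc by (simp add: good_def)
  then obtain g0 where g0: "good g0" and min: "\<And>g. good g \<Longrightarrow> degree g0 \<le> degree g"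
    using ex_has_least_nat[of good _ degree] by blast
  define g where "g = primitive_part g0"
  have g0_eq: "g0 = Polynomial.smult (content g0) g" by (simp add: g_def)
  have "g \<noteq> 0" "content g = 1" "degree g = degree g0" using g0 by (auto simp: g_def good_def)
  have "ev_root \<zeta> g0 = of_int (content g0) * ev_root \<zeta> g"
    by (subst g0_eq) simp
  then have ev_g: "ev_root \<zeta> g = 0" using g0 by (auto simp: good_def)
  have dvd: "g dvd k" if "ev_root \<zeta> k = 0" for k
  proof -
    \<comment> \<open>Pseudo-division makes \<open>g\<close> divide a multiple of \<open>k\<close>; multiplicativity of contents
      removes the factor.\<close>
    obtain Q r where qr: "pseudo_divmod k g = (Q, r)" by fastforce
    note * = pseudo_divmod[OF \<open>g \<noteq> 0\<close> qr]
    define c where "c = coeff g (degree g) ^ (Suc (degree k) - degree g)"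
    have k: "Polynomial.smult c k = g * Q + r" using *(1) by (simp add: c_def)
    have "c \<noteq> 0" using \<open>g \<noteq> 0\<close> by (simp add: c_def)
    have "ev_root \<zeta> r = 0"
      using arg_cong[OF k, of "ev_root \<zeta>"] that ev_g by simp
    then have "r = 0" using *(2) min[of r] \<open>degree g = degree g0\<close>
      unfolding good_def by (metis not_less)
    with k have k: "Polynomial.smult c k = g * Q" by simp
    then have "content (Polynomial.smult c k) = content Q"
      using \<open>content g = 1\<close> by (simp add: content_mult)
    then have "c dvd content Q" by (metis content_smult dvd_triv_left normalize_dvd_iff dvd_trans)
    then obtain e where e: "content Q = c * e" by blast
    have "Q = Polynomial.smult (content Q) (primitive_part Q)" by simp
    then have "Q = Polynomial.smult c (Polynomial.smult e (primitive_part Q))"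
      unfolding e by simp
    then have "Polynomial.smult c k = Polynomial.smult c (g * Polynomial.smult e (primitive_part Q))"
      using k by (metis mult_smult_right)
    then have "k = g * Polynomial.smult e (primitive_part Q)"
      using \<open>c \<noteq> 0\<close> by (metis smult_cancel)
    then show ?thesis by (rule dvdI)
  qed
  from dvd[OF ev_cyc] obtain k where k: "Polynomial.monom 1 n - 1 = g * k" ..
  have "red g = (0 :: 'p mod_ring)"
  proof (rule ccontr)
    assume red_g: "red g \<noteq> (0 :: 'p mod_ring)"
    let ?g = "of_int_poly g :: 'p mod_ring poly"
    have eq: "[:-1, 1:] ^ n = ?g * of_int_poly k"
      using arg_cong[OF k, of "of_int_poly :: int poly \<Rightarrow> 'p mod_ring poly"]
      by (simp add: hom_distribs linear_power_card n_def)
    have "\<not> [:-1, 1:] dvd ?g"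
      using red_g unfolding red_eq_poly by (metis poly_eq_0_iff_dvd minus_minus)
    moreover have "prime_elem [:-1, 1 :: 'p mod_ring:]"
      by (rule prime_elem_linear_field_poly) simp
    ultimately have "coprime [:-1, 1:] ?g"
      by (rule prime_elem_imp_coprime[rotated])
    then have "coprime ([:-1, 1:] ^ n) ?g" by simp
    then have "?g dvd 1" by (metis eq coprime_common_divisor dvd_refl dvd_triv_left)
    then have "degree ?g = 0" by (rule poly_dvd_1[THEN iffD1, THEN conjunct1])
    moreover have "degree ?g = degree g"
    proof -
      have "degree (Polynomial.monom 1 n - 1 :: int poly) = n"
        using n degree_add_eq_left[of "-1" "Polynomial.monom 1 n :: int poly"]
        by (simp add: degree_monom_eq)
      then have "lead_coeff (Polynomial.monom 1 n - 1 :: int poly) = 1"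
        using n by simp
      then have "lead_coeff g * lead_coeff k = 1" by (simp add: k lead_coeff_mult)
      then have "of_int (lead_coeff g) * of_int (lead_coeff k) = (1 :: 'p mod_ring)"
        by (metis of_int_1 of_int_mult)
      then have "of_int (lead_coeff g) \<noteq> (0 :: 'p mod_ring)" by auto
      then show ?thesis by (intro degree_map_poly) auto
    qed
    ultimately have "degree g = 0" by simp
    then obtain c where "g = [:c:]" by (metis degree_eq_zeroE)
    then show False using ev_g \<open>g \<noteq> 0\<close> by (simp add: ev_root_def)
  qed
  moreover obtain k where "h = g * k" using dvd[OF assms(2)] ..
  ultimately show ?thesis by simp
qed

text \<open>Total ramification of \<open>p\<close> in \<open>\<int>[\<zeta>]\<close>: up to sign, \<open>(\<zeta> - 1) ^ (p - 1)\<close> is \<open>p\<close> times an element that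
  reduces to \<open>1\<close>. Here \<open>p V\<close> is the difference of \<open>1 + X + \<dots> + X ^ (p - 1)\<close> and \<open>(X - 1) ^ (p - 1)\<close>.\<close>

lemma ramification:
  obtains V :: "int poly" where "poly V 1 = 1"
    and "\<And>\<zeta>. \<zeta> ^ CARD('p::prime_card) = 1 \<Longrightarrow> \<zeta> \<noteq> 1 \<Longrightarrow>
      of_nat CARD('p) * ev_root \<zeta> V = - ((\<zeta> - 1) ^ (CARD('p) - 1))"
proof -
  define n where "n = CARD('p)"
  have n: "n > 1" using prime_card[where ?'a = 'p] prime_gt_1_nat by (simp add: n_def)
  define \<Phi> :: "int poly" where "\<Phi> = (\<Sum>i<n. Polynomial.monom 1 i)"
  have geo: "[:-1, 1:] * (\<Sum>i<n. Polynomial.monom 1 i) = (Polynomial.monom 1 n - 1 :: 'a::comm_ring_1 poly)"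
    using power_diff_1_eq[of "[:0, 1:] :: 'a poly" n] by (simp add: monom_altdef one_pCons)
  have "[:-1, 1:] * of_int_poly \<Phi> = [:-1, 1:] * ([:-1, 1:] ^ (n - 1) :: 'p mod_ring poly)"
  proof -
    have "of_int_poly \<Phi> = (\<Sum>i<n. Polynomial.monom 1 i :: 'p mod_ring poly)"
      by (simp add: \<Phi>_def hom_distribs)
    moreover have "[:-1, 1:] * ([:-1, 1:] ^ (n - 1) :: 'p mod_ring poly) = [:-1, 1:] ^ n"
      using n by (metis Suc_diff_1 less_trans power_Suc zero_less_one)
    ultimately show ?thesis using geo linear_power_card[where ?'p = 'p] by (simp add: n_def)
  qed
  then have "of_int_poly \<Phi> = ([:-1, 1:] ^ (n - 1) :: 'p mod_ring poly)"
    by (subst (asm) mult_cancel_left) simp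
  then have "of_int_poly (\<Phi> - [:-1, 1:] ^ (n - 1)) = (0 :: 'p mod_ring poly)"
    by (simp add: hom_distribs)
  then obtain V where V: "\<Phi> - [:-1, 1:] ^ (n - 1) = Polynomial.smult (int n) V"
    unfolding n_def by (rule of_int_poly_eq_0_imp_smult)
  show ?thesis
  proof
    have "poly (\<Phi> - [:-1, 1:] ^ (n - 1)) 1 = int n"
      using n by (simp add: \<Phi>_def poly_sum poly_monom)
    then have "int n * poly V 1 = int n" unfolding V by simp
    then show "poly V 1 = 1" using n by simp
  next
    fix \<zeta> :: complex assume z: "\<zeta> ^ CARD('p) = 1" "\<zeta> \<noteq> 1"
    have "ev_root \<zeta> [:-1, 1:] * ev_root \<zeta> \<Phi> = ev_root \<zeta> ([:-1, 1:] * \<Phi>)"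
      by (simp only: ev_root_simps)
    also have "\<dots> = 0"
      unfolding \<Phi>_def geo using z by (simp add: n_def)
    finally have "ev_root \<zeta> \<Phi> = 0" using z by simp
    then show "of_nat CARD('p) * ev_root \<zeta> V = - ((\<zeta> - 1) ^ (CARD('p) - 1))"
      using arg_cong[OF V, of "ev_root \<zeta>"] by (simp add: n_def)
  qed
qed

text \<open>If \<open>A\<close> vanishes to order \<open>d\<close> at \<open>1\<close> modulo \<open>p\<close>, then \<open>V A\<close> is divisible by \<open>(\<zeta> - 1) ^ d\<close> in \<open>\<int>[\<zeta>]\<close>,
  with the expected reduction of the quotient. The bound on \<open>d\<close> ensures that the multiples of \<open>p\<close>
  which arise on lifting from characteristic \<open>p\<close> reduce to zero even after the division.\<close>

lemma divide_by_uniformizer: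
  fixes A :: "int poly" and B :: "'p::prime_card mod_ring poly"
  assumes \<zeta>: "\<zeta> ^ CARD('p) = 1" "\<zeta> \<noteq> 1"
    and V: "poly V 1 = 1" "of_nat CARD('p) * ev_root \<zeta> V = - ((\<zeta> - 1) ^ (CARD('p) - 1))"
    and d: "d + 2 \<le> CARD('p)"
    and A: "of_int_poly A = [:-1, 1:] ^ d * B"
  shows "\<exists>v. ev_root \<zeta> (V * A) = (\<zeta> - 1) ^ d * ev_root \<zeta> v \<and> red v = poly B 1"
proof -
  define B' where "B' = map_poly to_int_mod_ring B"
  have B': "of_int_poly B' = B"
    unfolding B'_def by (intro poly_eqI)
      (simp add: coeff_map_poly of_int_of_int_mod_ring)
  have "of_int_poly (A - [:-1, 1:] ^ d * B') = (0 :: 'p mod_ring poly)"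
    using A B' by (simp add: hom_distribs)
  then obtain E where E: "A - [:-1, 1:] ^ d * B' = Polynomial.smult (int CARD('p)) E"
    by (rule of_int_poly_eq_0_imp_smult)
  define v where "v = V * B' - [:-1, 1:] ^ (CARD('p) - 1 - d) * E"
  have A': "A = [:-1, 1:] ^ d * B' + Polynomial.smult (int CARD('p)) E"
    using E by (simp add: algebra_simps)
  have "ev_root \<zeta> (V * A)
      = (\<zeta> - 1) ^ d * ev_root \<zeta> (V * B') + (of_nat CARD('p) * ev_root \<zeta> V) * ev_root \<zeta> E"
    unfolding A' by (simp add: algebra_simps)
  also have "of_nat CARD('p) * ev_root \<zeta> V = - ((\<zeta> - 1) ^ d * (\<zeta> - 1) ^ (CARD('p) - 1 - d))"
    unfolding V(2) using d by (simp flip: power_add)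
  finally have "ev_root \<zeta> (V * A) = (\<zeta> - 1) ^ d * ev_root \<zeta> v"
    by (simp add: v_def algebra_simps)
  moreover have "red v = poly B 1"
    using d V(1) by (simp add: v_def red_eq_poly B' hom_distribs)
  ultimately show ?thesis by blast
qed

section \<open>Additive characters and exponential sums\<close>

lemma fact_mult_binomial_eq_prod:
  "of_nat (fact k) * of_nat (n choose k) = (\<Prod>i<k. of_nat n - of_nat i :: 'a::comm_ring_1)"
proof (induction k)
  case 0
  show ?case by simp
next
  case (Suc k)
  have "Suc k * (n choose Suc k) = (n - k) * (n choose k)"
    by (simp only: binomial_absorption binomial_absorb_comp)
  then have "of_nat (Suc k) * of_nat (n choose Suc k) = (of_nat ((n - k) * (n choose k)) :: 'a)"
    by (metis of_nat_mult)
  also have "\<dots> = (of_nat n - of_nat k) * of_nat (n choose k)"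
    by (cases "k \<le> n") (simp_all add: of_nat_diff binomial_eq_0)
  finally have *: "of_nat (Suc k) * of_nat (n choose Suc k)
      = ((of_nat n - of_nat k) * of_nat (n choose k) :: 'a)" .
  have "of_nat (fact (Suc k)) * of_nat (n choose Suc k)
      = of_nat (fact k) * (of_nat (Suc k) * of_nat (n choose Suc k) :: 'a)"
    by (simp add: algebra_simps)
  also have "\<dots> = of_nat (fact k) * of_nat (n choose k) * (of_nat n - of_nat k)"
    unfolding * by (simp add: algebra_simps)
  finally show ?case using Suc by simp
qed

lemma fact_mod_ring_nonzero:
  assumes "k < CARD('p::prime_card)"
  shows "of_nat (fact k) \<noteq> (0 :: 'p mod_ring)"
proof
  assume "of_nat (fact k) = (0 :: 'p mod_ring)"
  then have "CARD('p) dvd fact k" by (rule of_nat_0_mod_ring_dvd)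
  then show False using assms prime_card[where ?'a = 'p] by (simp add: prime_dvd_fact_iff)
qed

lemma choose_mod_ring_nonzero:
  assumes "i \<le> d" "d < CARD('p::prime_card)"
  shows "of_nat (d choose i) \<noteq> (0 :: 'p mod_ring)"
proof
  assume "of_nat (d choose i) = (0 :: 'p mod_ring)"
  moreover have "of_nat (fact d) = of_nat (fact i * fact (d - i)) * (of_nat (d choose i) :: 'p mod_ring)"
    using binomial_fact_lemma[OF assms(1)] by (metis of_nat_mult)
  ultimately show False using fact_mod_ring_nonzero[OF assms(2)] by simp
qed

text \<open>Expanding \<open>X ^ N = (1 + (X - 1)) ^ N\<close> binomially, the coefficient of \<open>(X - 1) ^ k\<close> in the sum is a
  combination of the moments of order at most \<open>k\<close>.\<close>

lemma exponential_sum_divisible: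
  fixes c :: "'u \<Rightarrow> 'p::prime_card mod_ring" and N :: "'u \<Rightarrow> nat"
  assumes "finite Z" "d < CARD('p)"
    and mom: "\<And>l. l < d \<Longrightarrow> (\<Sum>u\<in>Z. c u * of_nat (N u) ^ l) = 0"
  obtains B where
    "(\<Sum>u\<in>Z. Polynomial.smult (c u) (Polynomial.monom 1 (N u))) = [:-1, 1:] ^ d * B"
    "of_nat (fact d) * poly B 1 = (\<Sum>u\<in>Z. c u * of_nat (N u) ^ d)"
proof -
  define M where "M = Max (insert d (N ` Z))"
  have M: "d \<le> M" "\<And>u. u \<in> Z \<Longrightarrow> N u \<le> M" using assms(1) by (auto simp: M_def)
  define t where "t = [:-1, 1 :: 'p mod_ring:]"
  define a where "a k = (\<Sum>u\<in>Z. c u * of_nat (N u choose k))" for k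
  have binom: "Polynomial.monom 1 n = (\<Sum>k\<le>M. Polynomial.smult (of_nat (n choose k)) (t ^ k))"
    if "n \<le> M" for n
  proof -
    have "Polynomial.monom 1 n = (t + 1) ^ n" by (simp add: monom_altdef t_def one_pCons)
    also have "\<dots> = (\<Sum>k\<le>n. Polynomial.smult (of_nat (n choose k)) (t ^ k))"
      by (simp add: binomial_ring of_nat_poly)
    also have "\<dots> = (\<Sum>k\<le>M. Polynomial.smult (of_nat (n choose k)) (t ^ k))"
      using that by (intro sum.mono_neutral_left ballI) (simp_all add: binomial_eq_0)
    finally show ?thesis .
  qed
  \<comment> \<open>The multiple \<open>k! a\<^sub>k\<close> is a combination of moments of order at most \<open>k\<close>, with leading coefficient \<open>1\<close>.\<close>
  have a: "of_nat (fact k) * a k = (if k = d then \<Sum>u\<in>Z. c u * of_nat (N u) ^ d else 0)" if "k \<le> d" for k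
  proof -
    define P where "P = (\<Prod>i<k. [:- of_nat i, 1 :: 'p mod_ring:])"
    have deg: "degree P = k" unfolding P_def by (subst degree_prod_eq_sum_degree) auto
    have lead: "coeff P k = 1"
      using lead_coeff_prod[of "\<lambda>i. [:- of_nat i, 1 :: 'p mod_ring:]" "{..<k}"] deg by (simp add: P_def)
    have "of_nat (fact k) * a k = (\<Sum>u\<in>Z. c u * poly P (of_nat (N u)))"
      unfolding a_def sum_distrib_left P_def poly_prod
      by (intro sum.cong) (auto simp flip: fact_mult_binomial_eq_prod)
    also have "\<dots> = (\<Sum>u\<in>Z. \<Sum>l\<le>k. coeff P l * (c u * of_nat (N u) ^ l))"
      by (simp add: poly_altdef deg sum_distrib_left algebra_simps)
    also have "\<dots> = (\<Sum>l\<le>k. coeff P l * (\<Sum>u\<in>Z. c u * of_nat (N u) ^ l))"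
      by (subst sum.swap) (simp add: sum_distrib_left)
    also have "\<dots> = (\<Sum>l\<le>k. if l = d then \<Sum>u\<in>Z. c u * of_nat (N u) ^ d else 0)"
      using that lead mom by (intro sum.cong) auto
    also have "\<dots> = (if k = d then \<Sum>u\<in>Z. c u * of_nat (N u) ^ d else 0)"
      using that by (simp add: sum.delta)
    finally show ?thesis .
  qed
  have a_0: "a k = 0" if "k < d" for k
    using a[of k] that fact_mod_ring_nonzero[of k, where ?'p = 'p] assms(2) by simp
  define B where "B = (\<Sum>k\<in>{d..M}. Polynomial.smult (a k) (t ^ (k - d)))"
  have "(\<Sum>u\<in>Z. Polynomial.smult (c u) (Polynomial.monom 1 (N u)))
      = (\<Sum>u\<in>Z. \<Sum>k\<le>M. Polynomial.smult (c u * of_nat (N u choose k)) (t ^ k))"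
    using M(2) by (intro sum.cong) (simp_all add: binom smult_sum2)
  also have "\<dots> = (\<Sum>k\<le>M. Polynomial.smult (a k) (t ^ k))"
    unfolding a_def by (subst sum.swap) (simp add: smult_sum)
  also have "\<dots> = (\<Sum>k\<in>{d..M}. Polynomial.smult (a k) (t ^ k))"
    by (intro sum.mono_neutral_right) (auto simp: a_0 not_le)
  also have "\<dots> = t ^ d * B"
    unfolding B_def sum_distrib_left by (intro sum.cong) (simp_all flip: power_add)
  finally have 1: "(\<Sum>u\<in>Z. Polynomial.smult (c u) (Polynomial.monom 1 (N u))) = t ^ d * B" .
  have "poly B 1 = (\<Sum>k\<in>{d..M}. if k = d then a d else 0)"
    unfolding B_def poly_sum by (intro sum.cong) (auto simp: t_def power_0_left)
  also have "\<dots> = a d" using M(1) by (simp add: sum.delta)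
  finally have "of_nat (fact d) * poly B 1 = (\<Sum>u\<in>Z. c u * of_nat (N u) ^ d)" using a[of d] by simp
  with 1 show thesis by (intro that) (simp_all add: t_def)
qed

text \<open>The standard primitive \<open>n\<close>-th root of unity.\<close>

definition zeta :: "nat \<Rightarrow> complex" where
  "zeta n = cis (2 * pi / real n)"

text \<open>The standard additive character of the field with \<open>p\<close> elements.\<close>

definition add_char :: "'p::prime_card mod_ring \<Rightarrow> complex" where
  "add_char a = zeta CARD('p) ^ nat (to_int_mod_ring a)"

lemma nat_to_int_mod_ring_less: "nat (to_int_mod_ring (a :: 'p::prime_card mod_ring)) < CARD('p)"
proof -
  have "to_int_mod_ring a \<in> range (to_int_mod_ring :: 'p mod_ring \<Rightarrow> int)" by simp
  then show ?thesis unfolding range_to_int_mod_ring by auto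
qed

lemma of_nat_nat_to_int_mod_ring [simp]:
  "of_nat (nat (to_int_mod_ring a)) = (a :: 'p::prime_card mod_ring)"
proof -
  have "to_int_mod_ring a \<in> range (to_int_mod_ring :: 'p mod_ring \<Rightarrow> int)" by simp
  then have "0 \<le> to_int_mod_ring a" unfolding range_to_int_mod_ring by auto
  then show ?thesis by (simp add: of_nat_of_int_mod_ring)
qed

lemma of_int_to_int_mod_ring [simp]: "of_int (to_int_mod_ring a) = (a :: 'p::prime_card mod_ring)"
  by (simp add: of_int_of_int_mod_ring)

lemma roots_of_unity_bij:
  assumes "n > 0"
  shows "bij_betw (\<lambda>k. zeta n ^ k) {..<n} {z. z ^ n = 1}"
proof -
  have "(\<lambda>k. zeta n ^ k) = (\<lambda>k. cis (2 * pi * real k / real n))"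
    by (intro ext) (simp add: zeta_def DeMoivre algebra_simps)
  then show ?thesis using bij_betw_roots_unity[OF assms] by simp
qed

lemma zeta_power_card: "n > 0 \<Longrightarrow> zeta n ^ n = 1"
  by (simp add: zeta_def DeMoivre)

lemma add_char_of_nat: "add_char (of_nat k :: 'p::prime_card mod_ring) = zeta CARD('p) ^ k"
proof -
  have "nat (to_int_mod_ring (of_nat k :: 'p mod_ring)) = k mod CARD('p)"
    unfolding of_nat_of_int_mod_ring o_def by transfer (simp flip: zmod_int)
  then have "add_char (of_nat k :: 'p mod_ring) = zeta CARD('p) ^ (k mod CARD('p))"
    by (simp add: add_char_def)
  also have "\<dots> = zeta CARD('p) ^ (CARD('p) * (k div CARD('p)) + k mod CARD('p))"
    unfolding power_add power_mult by (simp add: zeta_power_card)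
  finally show ?thesis by simp
qed

lemma add_char_add: "add_char (a + b) = add_char a * add_char (b :: 'p::prime_card mod_ring)"
proof -
  obtain i j where "a = of_nat i" "b = of_nat j" by (metis of_nat_nat_to_int_mod_ring)
  then show ?thesis by (simp add: add_char_of_nat power_add flip: of_nat_add)
qed

lemma add_char_0 [simp]: "add_char 0 = 1"
  by (simp add: add_char_def)

lemma add_char_nonzero [simp]: "add_char a \<noteq> 0"
  by (simp add: add_char_def zeta_def)

lemma add_char_inj: "inj (add_char :: 'p::prime_card mod_ring \<Rightarrow> complex)"
proof (rule injI)
  fix a b :: "'p mod_ring" assume "add_char a = add_char b"
  then have "nat (to_int_mod_ring a) = nat (to_int_mod_ring b)"
    using bij_betw_imp_inj_on[OF roots_of_unity_bij, of "CARD('p)"]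
      nat_to_int_mod_ring_less[of a] nat_to_int_mod_ring_less[of b]
    by (auto simp: add_char_def inj_on_def)
  then show "a = b" by (metis of_nat_nat_to_int_mod_ring)
qed

lemma add_char_surj:
  assumes "z ^ CARD('p) = 1"
  obtains a :: "'p::prime_card mod_ring" where "z = add_char a"
proof -
  obtain k where "z = zeta CARD('p) ^ k"
    using assms bij_betw_imp_surj_on[OF roots_of_unity_bij, of "CARD('p)"] by auto
  then show thesis using that[of "of_nat k"] by (simp add: add_char_of_nat)
qed

lemma zeta_neq_1: "zeta CARD('p::prime_card) \<noteq> 1"
proof
  assume "zeta CARD('p) = 1"
  then have "add_char (1 :: 'p mod_ring) = add_char 0" by (simp add: add_char_def)
  then show False using injD[OF add_char_inj, of 1 "0 :: 'p mod_ring"] by simp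
qed

text \<open>The standard bilinear form on the plane.\<close>

definition dot :: "'a::comm_ring_1 \<times> 'a \<Rightarrow> 'a \<times> 'a \<Rightarrow> 'a" where
  "dot u x = fst u * fst x + snd u * snd x"

lemma dot_add_left: "dot (u + v) x = dot u x + dot v x"
  and dot_add_right: "dot u (x + y) = dot u x + dot u y"
  and dot_commute: "dot u x = dot x u"
  by (simp_all add: dot_def algebra_simps)

lemma dot_nondegenerate:
  fixes x :: "'a::comm_ring_1 \<times> 'a"
  assumes "\<And>u. dot u x = 0"
  shows "x = 0"
  using assms[of "(1, 0)"] assms[of "(0, 1)"] by (simp add: dot_def prod_eq_iff)

text \<open>The Fourier transform with frequencies indexed by points of the plane, without normalization
  and without complex conjugation of the character.\<close>

definition dft :: "('p::prime_card mod_ring \<times> 'p mod_ring \<Rightarrow> complex) \<Rightarrow>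
    'p mod_ring \<times> 'p mod_ring \<Rightarrow> complex" where
  "dft f u = (\<Sum>x\<in>UNIV. f x * add_char (dot u x))"

section \<open>Polynomial functions annihilating a function\<close>

text \<open>Polynomial functions in two variables of total degree at most \<open>q\<close>, as the span of the monomials.\<close>

inductive poly_fun :: "nat \<Rightarrow> ('a::field \<times> 'a \<Rightarrow> 'a) \<Rightarrow> bool" for q where
  monomial: "i + j \<le> q \<Longrightarrow> poly_fun q (\<lambda>x. fst x ^ i * snd x ^ j)"
| add: "poly_fun q g \<Longrightarrow> poly_fun q h \<Longrightarrow> poly_fun q (\<lambda>x. g x + h x)"
| scale: "poly_fun q g \<Longrightarrow> poly_fun q (\<lambda>x. c * g x)"

lemma poly_fun_affine_mult:
  assumes "poly_fun q g"
  shows "poly_fun (Suc q) (\<lambda>x. (\<alpha> * fst x + \<beta> * snd x + \<gamma>) * g x)"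
  using assms
proof induction
  case (monomial i j)
  have "poly_fun (Suc q) (\<lambda>x. (\<alpha> * (fst x ^ Suc i * snd x ^ j) + \<beta> * (fst x ^ i * snd x ^ Suc j))
      + \<gamma> * (fst x ^ i * snd x ^ j))"
    using monomial by (intro poly_fun.intros) auto
  then show ?case by (simp add: algebra_simps)
next
  case (add g h)
  then show ?case using poly_fun.add[OF add.IH] by (simp add: algebra_simps)
next
  case (scale g c)
  then show ?case using poly_fun.scale[OF scale.IH, of c] by (simp add: algebra_simps)
qed

lemma moments_of_dot:
  fixes c :: "'a::comm_ring_1 \<times> 'a \<Rightarrow> 'a"
  assumes "\<And>a b. a + b \<le> q \<Longrightarrow> (\<Sum>u\<in>Z. c u * (fst u ^ a * snd u ^ b)) = (if a = i \<and> b = j then \<kappa> else 0)"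
    and "l \<le> q"
  shows "(\<Sum>u\<in>Z. c u * dot u x ^ l)
    = (if l = i + j then of_nat (l choose i) * \<kappa> * (fst x ^ i * snd x ^ j) else 0)"
proof -
  have "(\<Sum>u\<in>Z. c u * dot u x ^ l) = (\<Sum>u\<in>Z. \<Sum>a\<le>l.
      of_nat (l choose a) * (fst x ^ a * snd x ^ (l - a)) * (c u * (fst u ^ a * snd u ^ (l - a))))"
    by (simp add: dot_def binomial_ring sum_distrib_left power_mult_distrib algebra_simps)
  also have "\<dots> = (\<Sum>a\<le>l. of_nat (l choose a) * (fst x ^ a * snd x ^ (l - a))
      * (\<Sum>u\<in>Z. c u * (fst u ^ a * snd u ^ (l - a))))"
    by (subst sum.swap) (simp add: sum_distrib_left)
  also have "\<dots> = (\<Sum>a\<le>l. if a = i then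
      (if l = i + j then of_nat (l choose i) * \<kappa> * (fst x ^ i * snd x ^ j) else 0) else 0)"
    using assms(2) by (intro sum.cong refl) (subst assms(1), auto)
  also have "\<dots> = (if l = i + j then of_nat (l choose i) * \<kappa> * (fst x ^ i * snd x ^ j) else 0)"
    by (auto simp: sum.delta)
  finally show ?thesis .
qed

text \<open>The relations \<open>dft f u = 0\<close> are combined with weights on the zeros \<open>u\<close> of the transform for which all
  moments of order at most \<open>q\<close> vanish except the one belonging to the given monomial of degree
  \<open>d = i + j\<close>. The resulting exponential sum is divisible by \<open>(\<zeta> - 1) ^ d\<close>, and the quotient reduces to
  that monomial.\<close>

lemma monomial_realizable:
  fixes f :: "'p::prime_card mod_ring \<times> 'p mod_ring \<Rightarrow> complex"
  assumes q: "q + 2 \<le> CARD('p)" and X: "card {u. dft f u \<noteq> 0} < CARD('p) * (CARD('p) - q)"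
    and ij: "i + j \<le> q"
  shows "\<exists>v. (\<Sum>x\<in>UNIV. f x * ev_root (zeta CARD('p)) (v x)) = 0 \<and>
    (\<forall>x. red (v x) = fst x ^ i * snd x ^ j)"
proof -
  let ?\<zeta> = "zeta CARD('p)"
  define d where "d = i + j"
  define Z where "Z = {u. dft f u = 0}"
  have "card Z = CARD('p) * CARD('p) - card {u. dft f u \<noteq> 0}"
  proof -
    have "Z = UNIV - {u. dft f u \<noteq> 0}" by (auto simp: Z_def)
    then have "card Z = CARD('p mod_ring \<times> 'p mod_ring) - card {u. dft f u \<noteq> 0}"
      by (simp only:) (subst card_Diff_subset, auto)
    then show ?thesis by (simp only: card_prod CARD_mod_ring)
  qed
  moreover have "CARD('p) * (CARD('p) - q) + CARD('p) * q = CARD('p) * CARD('p)"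
    using q by (simp flip: distrib_left)
  ultimately have "CARD('p mod_ring) * q < card Z" using X by simp
  \<comment> \<open>The target moment is normalized so that the quotient reduces to the monomial itself.\<close>
  from exists_weights_monomials[OF this,
      of "\<lambda>a b. if a = i \<and> b = j then of_nat (fact d) / of_nat (d choose i) else 0"]
  obtain c where c:
    "\<And>a b. a + b \<le> q \<Longrightarrow> (\<Sum>u\<in>Z. c u * (fst u ^ a * snd u ^ b))
      = (if a = i \<and> b = j then of_nat (fact d) / of_nat (d choose i) else 0)"
    by blast
  note mom = moments_of_dot[OF c]
  define N where "N u x = nat (to_int_mod_ring (dot u x))" for u x :: "'p mod_ring \<times> 'p mod_ring"
  define A where "A x = (\<Sum>u\<in>Z. Polynomial.smult (to_int_mod_ring (c u)) (Polynomial.monom 1 (N u x)))"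
    for x
  have ev_A: "(\<Sum>x\<in>UNIV. f x * ev_root ?\<zeta> (A x)) = 0"
  proof -
    have "(\<Sum>x\<in>UNIV. f x * ev_root ?\<zeta> (A x))
        = (\<Sum>x\<in>UNIV. \<Sum>u\<in>Z. of_int (to_int_mod_ring (c u)) * (f x * add_char (dot u x)))"
      by (simp add: A_def ev_root_sum add_char_def N_def sum_distrib_left algebra_simps)
    also have "\<dots> = (\<Sum>u\<in>Z. of_int (to_int_mod_ring (c u)) * dft f u)"
      by (subst sum.swap) (simp add: dft_def sum_distrib_left)
    also have "\<dots> = 0" by (intro sum.neutral) (simp add: Z_def)
    finally show ?thesis .
  qed
  obtain V where V: "poly V 1 = 1"
    "of_nat CARD('p) * ev_root ?\<zeta> V = - ((?\<zeta> - 1) ^ (CARD('p) - 1))"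
    using ramification[where ?'p = 'p] zeta_power_card zeta_neq_1[where ?'p = 'p]
    by (metis zero_less_card_finite)
  have "\<exists>v. ev_root ?\<zeta> (V * A x) = (?\<zeta> - 1) ^ d * ev_root ?\<zeta> v \<and>
      red v = fst x ^ i * snd x ^ j" for x
  proof -
    have d: "d < CARD('p)" "d + 2 \<le> CARD('p)" using q ij by (simp_all add: d_def)
    have *: "(\<Sum>u\<in>Z. c u * of_nat (N u x) ^ l) = (if l = i + j then
        of_nat (l choose i) * (of_nat (fact d) / of_nat (d choose i)) * (fst x ^ i * snd x ^ j) else 0)"
      if "l \<le> d" for l
      using mom[where l = l and x = x] that ij by (simp add: N_def d_def)
    have "(\<Sum>u\<in>Z. c u * of_nat (N u x) ^ l) = 0" if "l < d" for l
      using *[of l] that by (simp add: d_def)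
    from exponential_sum_divisible[OF finite d(1) this]
    obtain B where B: "(\<Sum>u\<in>Z. Polynomial.smult (c u) (Polynomial.monom 1 (N u x))) = [:-1, 1:] ^ d * B"
      "of_nat (fact d) * poly B 1 = (\<Sum>u\<in>Z. c u * of_nat (N u x) ^ d)" by blast
    have "of_int_poly (A x) = [:-1, 1:] ^ d * B"
      unfolding B(1)[symmetric] A_def by (simp add: hom_distribs)
    from divide_by_uniformizer[OF _ _ V d(2) this] obtain v where v:
      "ev_root ?\<zeta> (V * A x) = (?\<zeta> - 1) ^ d * ev_root ?\<zeta> v" "red v = poly B 1"
      using zeta_power_card zeta_neq_1[where ?'p = 'p] by auto
    have "poly B 1 = fst x ^ i * snd x ^ j"
      using B(2) *[of d] fact_mod_ring_nonzero[OF d(1)] choose_mod_ring_nonzero[of i d, where ?'p = 'p] d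
      by (simp add: d_def)
    with v show ?thesis by auto
  qed
  then obtain v where v: "\<And>x. ev_root ?\<zeta> (V * A x) = (?\<zeta> - 1) ^ d * ev_root ?\<zeta> (v x)"
    "\<And>x. red (v x) = fst x ^ i * snd x ^ j" by metis
  have "(?\<zeta> - 1) ^ d * (\<Sum>x\<in>UNIV. f x * ev_root ?\<zeta> (v x))
      = (\<Sum>x\<in>UNIV. f x * ev_root ?\<zeta> (V * A x))"
    unfolding v(1) sum_distrib_left by (intro sum.cong refl) (simp only: mult.left_commute)
  also have "\<dots> = ev_root ?\<zeta> V * (\<Sum>x\<in>UNIV. f x * ev_root ?\<zeta> (A x))"
    unfolding sum_distrib_left by (simp add: algebra_simps)
  also have "\<dots> = 0" by (simp only: ev_A mult_zero_right)
  finally have "(\<Sum>x\<in>UNIV. f x * ev_root ?\<zeta> (v x)) = 0"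
    using zeta_neq_1[where ?'p = 'p] by simp
  with v(2) show ?thesis by blast
qed

lemma poly_fun_realizable:
  fixes f :: "'p::prime_card mod_ring \<times> 'p mod_ring \<Rightarrow> complex"
  assumes "q + 2 \<le> CARD('p)" "card {u. dft f u \<noteq> 0} < CARD('p) * (CARD('p) - q)"
    and "poly_fun q Q"
  shows "\<exists>v. (\<Sum>x\<in>UNIV. f x * ev_root (zeta CARD('p)) (v x)) = 0 \<and> (\<forall>x. red (v x) = Q x)"
  using assms(3)
proof induction
  case (monomial i j)
  then show ?case by (rule monomial_realizable[OF assms(1,2)])
next
  case (add g h)
  then obtain v w where "(\<Sum>x\<in>UNIV. f x * ev_root (zeta CARD('p)) (v x)) = 0" "\<forall>x. red (v x) = g x"
    "(\<Sum>x\<in>UNIV. f x * ev_root (zeta CARD('p)) (w x)) = 0" "\<forall>x. red (w x) = h x" by blast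
  then show ?case
    by (intro exI[of _ "\<lambda>x. v x + w x"]) (simp add: distrib_left sum.distrib)
next
  case (scale g c)
  then obtain v where v: "(\<Sum>x\<in>UNIV. f x * ev_root (zeta CARD('p)) (v x)) = 0" "\<forall>x. red (v x) = g x"
    by blast
  have "(\<Sum>x\<in>UNIV. f x * ev_root (zeta CARD('p)) (Polynomial.smult (to_int_mod_ring c) (v x)))
      = of_int (to_int_mod_ring c) * (\<Sum>x\<in>UNIV. f x * ev_root (zeta CARD('p)) (v x))"
    by (simp add: sum_distrib_left mult.left_commute)
  then show ?case using v
    by (intro exI[of _ "\<lambda>x. Polynomial.smult (to_int_mod_ring c) (v x)"]) simp
qed

section \<open>Separating a point by lines\<close>

text \<open>The direction of the line joining \<open>x\<close> to \<open>z\<close>, with \<^const>\<open>None\<close> for a vertical line. Points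
  \<open>x \<noteq> z\<close> of equal slope are exactly those on a common line through \<open>z\<close>; the point \<open>z\<close> itself has the
  spurious value \<^const>\<open>None\<close>.\<close>

definition slope :: "'a::field \<times> 'a \<Rightarrow> 'a \<times> 'a \<Rightarrow> 'a option" where
  "slope z x = (if fst x = fst z then None else Some ((snd x - snd z) / (fst x - fst z)))"

lemma slope_class_on_line:
  "\<exists>\<alpha> \<beta>. (\<alpha> \<noteq> 0 \<or> \<beta> \<noteq> 0) \<and> (\<forall>x. x = z \<or> slope z x = k \<longrightarrow>
     \<alpha> * fst x + \<beta> * snd x = \<alpha> * fst z + \<beta> * snd (z :: 'a::field \<times> 'a))"
proof (cases k)
  case None
  then show ?thesis
    by (intro exI[of _ 1] exI[of _ 0]) (auto simp: slope_def split: if_splits)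
next
  case (Some s)
  then show ?thesis
    by (intro exI[of _ "- s"] exI[of _ 1]) (auto simp: slope_def field_simps split: if_splits)
qed

lemma line_avoiding_point:
  assumes "a \<noteq> z" "b \<noteq> z" "slope z a \<noteq> slope z b \<or> a = b"
  obtains \<alpha> \<beta> \<gamma> where "\<alpha> * fst a + \<beta> * snd a + \<gamma> = 0" "\<alpha> * fst b + \<beta> * snd b + \<gamma> = 0"
    "\<alpha> * fst z + \<beta> * snd z + \<gamma> \<noteq> (0::'a::field)"
proof (cases "a = b")
  case True
  show ?thesis
  proof (cases "fst a = fst z")
    case True
    then have "snd a \<noteq> snd z" using assms(1) by (simp add: prod_eq_iff)
    then show ?thesis using that[of 0 1 "- snd a"] \<open>a = b\<close> by simp
  next
    case False
    then show ?thesis using that[of 1 0 "- fst a"] \<open>a = b\<close> by simp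
  qed
next
  case False
  with assms(3) have slope: "slope z a \<noteq> slope z b" by simp
  define \<alpha> \<beta> \<gamma> where "\<alpha> = snd a - snd b" and "\<beta> = fst b - fst a"
    and "\<gamma> = snd b * fst a - fst b * snd a"
  have "\<alpha> * fst z + \<beta> * snd z + \<gamma>
      = (snd b - snd z) * (fst a - fst z) - (snd a - snd z) * (fst b - fst z)"
    by (simp add: \<alpha>_def \<beta>_def \<gamma>_def algebra_simps)
  also have "\<dots> \<noteq> 0"
  proof (cases "fst a = fst z \<or> fst b = fst z")
    case True
    then show ?thesis using slope assms(1,2) by (auto simp: slope_def prod_eq_iff split: if_splits)
  next
    case False
    then show ?thesis using slope by (auto simp: slope_def field_simps)
  qed
  finally show ?thesis
    by (intro that[of \<alpha> \<beta> \<gamma>]) (simp_all add: \<alpha>_def \<beta>_def \<gamma>_def algebra_simps)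
qed

text \<open>At most \<open>2 q\<close> points, no more than \<open>q\<close> of which are seen from \<open>z\<close> in the same direction, can be
  covered by \<open>q\<close> lines missing \<open>z\<close>; the product of the equations of these lines is \<open>Q\<close>. The points
  are removed in pairs with different slopes, taking the largest slope class first and then the
  largest among the others.\<close>

lemma cover_by_lines_avoiding_point:
  fixes T :: "('a::field \<times> 'a) set"
  assumes "finite T" "z \<notin> T" "card T \<le> 2 * q" "\<And>k. card {x \<in> T. slope z x = k} \<le> q"
  shows "\<exists>Q. poly_fun q Q \<and> Q z \<noteq> 0 \<and> (\<forall>x\<in>T. Q x = 0)"
  using assms
proof (induction q arbitrary: T)
  case 0
  then have "T = {}" by simp
  then show ?case using poly_fun.monomial[of 0 0 0] by auto
next
  case (Suc q)
  define cl where "cl k = {x \<in> T. slope z x = k}" for k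
  have fin: "finite (cl k)" for k using Suc.prems(1) by (simp add: cl_def)
  show ?case
  proof (cases "T = {}")
    case True
    then show ?thesis using poly_fun.monomial[of 0 0 "Suc q"] by auto
  next
    case False
    have bd: "card (cl k) < Suc (card T)" for k
      using Suc.prems(1) by (simp add: cl_def card_mono less_Suc_eq_le)
    obtain a where a: "a \<in> T" "\<And>t. t \<in> T \<Longrightarrow> card (cl (slope z t)) \<le> card (cl (slope z a))"
      using ex_has_greatest_nat[of "\<lambda>t. t \<in> T" _ "\<lambda>t. card (cl (slope z t))" "Suc (card T)"] False bd
      by blast
    obtain b where b: "b \<in> T" "slope z a \<noteq> slope z b \<or> a = b"
      "\<And>t. t \<in> T \<Longrightarrow> slope z t \<noteq> slope z a \<Longrightarrow>
         slope z a \<noteq> slope z b \<and> card (cl (slope z t)) \<le> card (cl (slope z b))"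
    proof (cases "\<exists>t\<in>T. slope z t \<noteq> slope z a")
      case True
      then show ?thesis
        using that ex_has_greatest_nat[of "\<lambda>t. t \<in> T \<and> slope z t \<noteq> slope z a" _
            "\<lambda>t. card (cl (slope z t))" "Suc (card T)"] bd by metis
    next
      case False
      then show ?thesis using that[of a] a(1) by blast
    qed
    define T' where "T' = T - {a, b}"
    have classes: "card {x \<in> T'. slope z x = k} \<le> q" for k
    proof (cases "k = slope z a \<or> k = slope z b")
      case True
      then have "{x \<in> T'. slope z x = k} \<subset> cl k"
        using a(1) b(1) by (auto simp: T'_def cl_def)
      then have "card {x \<in> T'. slope z x = k} < card (cl k)" by (intro psubset_card_mono fin)
      then show ?thesis using Suc.prems(4)[of k] by (simp add: cl_def)
    next
      case False
      have sub: "card {x \<in> T'. slope z x = k} \<le> card (cl k)"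
        by (intro card_mono fin) (auto simp: T'_def cl_def)
      show ?thesis
      proof (cases "cl k = {}")
        case True
        then show ?thesis using sub by simp
      next
        case nonempty: False
        then obtain t where t: "t \<in> T" "slope z t = k" by (auto simp: cl_def)
        have ab: "slope z a \<noteq> slope z b" using b(3)[OF t(1)] t(2) False by auto
        have "card (cl k) \<le> card (cl (slope z a))" "card (cl k) \<le> card (cl (slope z b))"
          using a(2)[OF t(1)] b(3)[OF t(1)] t(2) False by auto
        moreover have "card (cl k) + card (cl (slope z a)) + card (cl (slope z b))
            = card (cl k \<union> cl (slope z a) \<union> cl (slope z b))"
          using False ab fin by (subst card_Un_disjoint; (subst card_Un_disjoint)?) (auto simp: cl_def)
        moreover have "card (cl k \<union> cl (slope z a) \<union> cl (slope z b)) \<le> card T"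
          using Suc.prems(1) by (intro card_mono) (auto simp: cl_def)
        \<comment> \<open>A third slope class is at most as large as those of \<open>a\<close> and \<open>b\<close>, so it has at most a third of all points.\<close>
        ultimately have "3 * card (cl k) \<le> 2 * Suc q" using Suc.prems(3) by linarith
        then have "card (cl k) \<le> q" by presburger
        then show ?thesis using sub by linarith
      qed
    qed
    have "card T' \<le> 2 * q"
    proof (cases "a = b")
      case True
      have "slope z t = slope z a" if "t \<in> T" for t
        using b(3)[OF that] True by blast
      then have "T' = {x \<in> T'. slope z x = slope z a}" by (auto simp: T'_def)
      then show ?thesis using classes[of "slope z a"] by simp
    next
      case False
      then have "card T' = card T - 2"
        using Suc.prems(1) a(1) b(1) by (simp add: T'_def card_Diff_subset)
      then show ?thesis using Suc.prems(3) by simp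
    qed
    then obtain Q where Q: "poly_fun q Q" "Q z \<noteq> 0" "\<And>x. x \<in> T' \<Longrightarrow> Q x = 0"
      using Suc.IH[of T'] Suc.prems(1,2) classes by (auto simp: T'_def)
    have "a \<noteq> z" "b \<noteq> z" using a(1) b(1) Suc.prems(2) by auto
    then obtain \<alpha> \<beta> \<gamma> where L: "\<alpha> * fst a + \<beta> * snd a + \<gamma> = 0" "\<alpha> * fst b + \<beta> * snd b + \<gamma> = 0"
      "\<alpha> * fst z + \<beta> * snd z + \<gamma> \<noteq> 0"
      using b(2) by (rule line_avoiding_point)
    have "\<forall>x\<in>T. (\<alpha> * fst x + \<beta> * snd x + \<gamma>) * Q x = 0"
      using L(1,2) Q(3) by (auto simp: T'_def)
    then show ?thesis
      using poly_fun_affine_mult[OF Q(1), of \<alpha> \<beta> \<gamma>] L(3) Q(2)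
      by (intro exI[of _ "\<lambda>x. (\<alpha> * fst x + \<beta> * snd x + \<gamma>) * Q x"]) simp
  qed
qed

section \<open>Lines rich in support points\<close>

text \<open>By \<open>ker\<close>, the map \<open>red\<close> induces on the image of \<open>ev\<close> a reduction modulo a prime ideal.
  The relations in \<open>W\<close> form a linear system for \<open>f\<close> which, after ordering \<open>S\<close> suitably, is
  triangular with nonzero diagonal modulo this ideal; hence \<open>f = 0\<close>. The proof is Gaussian
  elimination.\<close>

lemma vanishing_by_isolation:
  fixes S :: "'x set" and f :: "'x \<Rightarrow> 'k::field"
    and ev :: "'r::comm_ring_1 \<Rightarrow> 'k" and red :: "'r \<Rightarrow> 'l::idom"
  assumes ev: "comm_ring_hom ev" and red: "comm_ring_hom red"
    and ker: "\<And>h. ev h = 0 \<Longrightarrow> red h = 0"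
    and "finite S"
    and rel: "\<And>v. v \<in> W \<Longrightarrow> (\<Sum>x\<in>S. f x * ev (v x)) = 0"
    and iso: "\<And>T. T \<subseteq> S \<Longrightarrow> T \<noteq> {} \<Longrightarrow>
      \<exists>x\<in>T. \<exists>v\<in>W. red (v x) \<noteq> 0 \<and> (\<forall>y\<in>T - {x}. red (v y) = 0)"
  shows "\<forall>x\<in>S. f x = 0"
  using \<open>finite S\<close> rel iso
proof (induction "card S" arbitrary: S W)
  case 0
  then show ?case by simp
next
  case (Suc n)
  interpret ev: comm_ring_hom ev by (rule ev)
  interpret red: comm_ring_hom red by (rule red)
  from Suc have "S \<noteq> {}" by auto
  with Suc.prems(3)[of S] obtain x0 v0 where x0: "x0 \<in> S" "v0 \<in> W" "red (v0 x0) \<noteq> 0"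
    and v0: "\<And>y. y \<in> S - {x0} \<Longrightarrow> red (v0 y) = 0" by blast
  \<comment> \<open>Row operation that eliminates the unknown \<open>f x0\<close>, using the pivot relation \<open>v0\<close>.\<close>
  define w where "w v x = v0 x0 * v x - v x0 * v0 x" for v x
  have split: "(\<Sum>x\<in>S. f x * ev (v x)) = f x0 * ev (v x0) + (\<Sum>x\<in>S - {x0}. f x * ev (v x))" for v
    using Suc.prems(1) x0(1) by (rule sum.remove)
  have "\<forall>x\<in>S - {x0}. f x = 0"
  proof (rule Suc.hyps(1)[where W = "w ` W"])
    show "n = card (S - {x0})" using Suc.hyps(2) x0(1) Suc.prems(1) by simp
    show "finite (S - {x0})" using Suc.prems(1) by simp
  next
    fix v' assume "v' \<in> w ` W"
    then obtain v where v: "v \<in> W" "v' = w v" by blast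
    have "(\<Sum>x\<in>S - {x0}. f x * ev (v' x)) = (\<Sum>x\<in>S. f x * ev (v' x))"
      using split[of v'] by (simp add: v(2) w_def mult.commute)
    also have "\<dots> = ev (v0 x0) * (\<Sum>x\<in>S. f x * ev (v x)) - ev (v x0) * (\<Sum>x\<in>S. f x * ev (v0 x))"
      unfolding v(2) w_def
      by (simp add: sum_distrib_left sum_subtractf ev.hom_minus ev.hom_mult algebra_simps)
    also have "\<dots> = 0" using Suc.prems(2)[OF v(1)] Suc.prems(2)[OF x0(2)] by simp
    finally show "(\<Sum>x\<in>S - {x0}. f x * ev (v' x)) = 0" .
  next
    fix T assume T: "T \<subseteq> S - {x0}" "T \<noteq> {}"
    with Suc.prems(3)[of T] obtain x v where x: "x \<in> T" "v \<in> W" "red (v x) \<noteq> 0"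
      "\<forall>y\<in>T - {x}. red (v y) = 0" by blast
    have "red (w v y) = red (v0 x0) * red (v y)" if "y \<in> T" for y
      using v0[of y] that T by (auto simp: w_def red.hom_minus red.hom_mult)
    then show "\<exists>x\<in>T. \<exists>v'\<in>w ` W. red (v' x) \<noteq> 0 \<and> (\<forall>y\<in>T - {x}. red (v' y) = 0)"
      using x x0(3) by (intro bexI[of _ x] bexI[of _ "w v"]) auto
  qed
  moreover from this have "f x0 * ev (v0 x0) = 0"
    using split[of v0] Suc.prems(2)[OF x0(2)] by simp
  then have "f x0 = 0" using ker[of "v0 x0"] x0(3) by auto
  ultimately show ?case by auto
qed

text \<open>A nonzero function with few nonzero values and few nonzero Fourier coefficients has many of its
  nonzero values on one line. The relation set \<open>W\<close> of the proof contains, for every polynomial function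
  of degree at most \<open>q\<close>, a relation reducing to it.\<close>

proposition rich_line_in_support:
  fixes f :: "'p::prime_card mod_ring \<times> 'p mod_ring \<Rightarrow> complex"
  assumes q: "q + 2 \<le> CARD('p)" and X: "card {u. dft f u \<noteq> 0} < CARD('p) * (CARD('p) - q)"
    and S: "card {x. f x \<noteq> 0} \<le> 2 * q + 1" and nz: "\<exists>x. f x \<noteq> 0"
  shows "\<exists>\<alpha> \<beta> \<gamma>. (\<alpha> \<noteq> 0 \<or> \<beta> \<noteq> 0) \<and>
    q + 2 \<le> card {x. f x \<noteq> 0 \<and> \<alpha> * fst x + \<beta> * snd x = \<gamma>}"
proof (rule ccontr)
  assume neg: "\<not> ?thesis"
  have poor: "card {x. f x \<noteq> 0 \<and> \<alpha> * fst x + \<beta> * snd x = \<gamma>} \<le> q + 1"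
    if "\<alpha> \<noteq> 0 \<or> \<beta> \<noteq> 0" for \<alpha> \<beta> \<gamma>
  proof -
    have "\<not> q + 2 \<le> card {x. f x \<noteq> 0 \<and> \<alpha> * fst x + \<beta> * snd x = \<gamma>}"
      using neg that by blast
    then show ?thesis by simp
  qed
  let ?\<zeta> = "zeta CARD('p)"
  define S where "S = {x. f x \<noteq> 0}"
  define W where "W = {v. (\<Sum>x\<in>S. f x * ev_root ?\<zeta> (v x)) = 0}"
  have "\<forall>x\<in>S. f x = 0"
  proof (rule vanishing_by_isolation[OF comm_ring_hom_ev_root comm_ring_hom_red])
    show "red h = (0 :: 'p mod_ring)" if "ev_root ?\<zeta> h = 0" for h
      using that zeta_power_card by (intro red_eq_0_of_ev_root_eq_0) auto
    show "finite S" by simp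
    show "(\<Sum>x\<in>S. f x * ev_root ?\<zeta> (v x)) = 0" if "v \<in> W" for v
      using that by (simp add: W_def)
    fix T assume T: "T \<subseteq> S" "T \<noteq> {}"
    then obtain z where z: "z \<in> T" by blast
    have "card {x \<in> T - {z}. slope z x = k} \<le> q" for k
    proof -
      obtain \<alpha> \<beta> where ab: "\<alpha> \<noteq> 0 \<or> \<beta> \<noteq> 0" "\<And>x. x = z \<or> slope z x = k \<Longrightarrow>
          \<alpha> * fst x + \<beta> * snd x = \<alpha> * fst z + \<beta> * snd z"
        using slope_class_on_line[of z k] by blast
      have "Suc (card {x \<in> T - {z}. slope z x = k}) = card (insert z {x \<in> T - {z}. slope z x = k})"
        by (rule card_insert_disjoint[symmetric]) (rule finite, blast)
      also have "\<dots> \<le> card {x. f x \<noteq> 0 \<and> \<alpha> * fst x + \<beta> * snd x = \<alpha> * fst z + \<beta> * snd z}"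
        using z T(1) ab(2) unfolding S_def by (intro card_mono) (rule finite, blast)
      also have "\<dots> \<le> q + 1" by (rule poor[OF ab(1)])
      finally show ?thesis by simp
    qed
    moreover have "card (T - {z}) \<le> 2 * q"
      using card_mono[OF _ T(1)] assms(3) z by (simp add: S_def)
    ultimately obtain Q where Q: "poly_fun q Q" "Q z \<noteq> 0" "\<forall>x\<in>T - {z}. Q x = 0"
      using cover_by_lines_avoiding_point[of "T - {z}" z q] by auto
    obtain v where v: "(\<Sum>x\<in>UNIV. f x * ev_root ?\<zeta> (v x)) = 0" "\<And>x. red (v x) = Q x"
      using poly_fun_realizable[OF q X Q(1)] by blast
    have "(\<Sum>x\<in>S. f x * ev_root ?\<zeta> (v x)) = (\<Sum>x\<in>UNIV. f x * ev_root ?\<zeta> (v x))"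
      by (intro sum.mono_neutral_left) (auto simp: S_def)
    then have "v \<in> W" using v(1) by (simp add: W_def)
    moreover have "red (v z) \<noteq> (0 :: 'p mod_ring) \<and> (\<forall>y\<in>T - {z}. red (v y) = (0 :: 'p mod_ring))"
      unfolding v(2) using Q by blast
    ultimately show "\<exists>x\<in>T. \<exists>v\<in>W. red (v x) \<noteq> (0 :: 'p mod_ring) \<and>
        (\<forall>y\<in>T - {x}. red (v y) = (0 :: 'p mod_ring))"
      using z by blast
  qed
  then show False using nz by (simp add: S_def)
qed

lemma dft_shift_combination:
  "dft (\<lambda>x. f x * (add_char (dot w x) - c)) u = dft f (u + w) - c * dft f u"
  by (simp add: dft_def dot_def sum_subtractf sum_distrib_left algebra_simps add_char_add)

text \<open>Multiplication by a character minus a constant at most doubles the support of the transform.\<close>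

lemma card_dft_supp_shift_combination:
  "card {u. dft (\<lambda>x. f x * (add_char (dot w x) - c)) u \<noteq> 0} \<le> 2 * card {u. dft f u \<noteq> 0}"
proof -
  let ?X = "{u. dft f u \<noteq> 0}"
  have "{u. dft (\<lambda>x. f x * (add_char (dot w x) - c)) u \<noteq> 0} \<subseteq> (\<lambda>u. u - w) ` ?X \<union> ?X"
  proof
    fix u assume "u \<in> {u. dft (\<lambda>x. f x * (add_char (dot w x) - c)) u \<noteq> 0}"
    then have *: "dft f (u + w) - c * dft f u \<noteq> 0"
      by (simp only: dft_shift_combination mem_Collect_eq not_False_eq_True)
    have "a \<noteq> 0 \<or> b \<noteq> 0" if "a - c * b \<noteq> 0" for a b using that by auto
    from this[OF *] show "u \<in> (\<lambda>u. u - w) ` ?X \<union> ?X"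
    proof
      assume "dft f (u + w) \<noteq> 0"
      then have "u + w \<in> ?X" by (rule CollectI)
      then have "u + w - w \<in> (\<lambda>u. u - w) ` ?X" by (rule imageI)
      then show ?thesis by (simp only: add_diff_cancel UnI1)
    next
      assume "dft f u \<noteq> 0"
      then show ?thesis by (intro UnI2 CollectI)
    qed
  qed
  then have "card {u. dft (\<lambda>x. f x * (add_char (dot w x) - c)) u \<noteq> 0}
      \<le> card ((\<lambda>u. u - w) ` ?X \<union> ?X)" by (rule card_mono[rotated]) (rule finite)
  also have "\<dots> \<le> card ((\<lambda>u. u - w) ` ?X) + card ?X" by (rule card_Un_le)
  also have "card ((\<lambda>u. u - w) ` ?X) \<le> card ?X" by (rule card_image_le) (rule finite)
  finally show ?thesis by simp
qed

text \<open>Let \<open>n\<close> and \<open>m\<close> be the sizes of the two supports and \<open>k\<close> the integer part of \<open>m / p\<close>. If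
  \<open>k = 0\<close>, a line would contain \<open>p > n\<close> points of the support. Otherwise a first line
  contains at least \<open>p + 1 - k\<close> points of the support. If the support were not contained in that line,
  multiplying \<open>f\<close> by a factor vanishing exactly on it would produce a second line, containing
  \<open>p - 2 k\<close> further points; together these are more than \<open>n\<close>.\<close>

lemma small_support_on_line:
  fixes f :: "'p::prime_card mod_ring \<times> 'p mod_ring \<Rightarrow> complex"
  assumes nz: "\<exists>x. f x \<noteq> 0"
    and nm: "card {x. f x \<noteq> 0} \<le> card {u. dft f u \<noteq> 0}"
    and small: "CARD('p) \<le> card {u. dft f u \<noteq> 0} \<Longrightarrow>
      card {x. f x \<noteq> 0} + 11 * (card {u. dft f u \<noteq> 0} div CARD('p)) < 2 * CARD('p)"
  shows "\<exists>\<alpha> \<beta> \<gamma>. (\<alpha> \<noteq> 0 \<or> \<beta> \<noteq> 0) \<and> (\<forall>x. f x \<noteq> 0 \<longrightarrow> \<alpha> * fst x + \<beta> * snd x = \<gamma>)"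
proof -
  define p n m k where "p = CARD('p)" and "n = card {x. f x \<noteq> 0}"
    and "m = card {u. dft f u \<noteq> 0}" and "k = m div p"
  have p: "p \<ge> 2" using prime_card[where ?'a = 'p] prime_ge_2_nat by (simp add: p_def)
  have m_lt: "m < p * (k + 1)"
    unfolding k_def using p by (simp add: dividend_less_times_div)
  show ?thesis
  proof (cases "p \<le> m")
    case False
    \<comment> \<open>With \<open>q = p - 2\<close> the line would carry \<open>p\<close> points of the support, which has fewer.\<close>
    have "\<exists>\<alpha> \<beta> \<gamma>. (\<alpha> \<noteq> 0 \<or> \<beta> \<noteq> 0) \<and>
        (p - 2) + 2 \<le> card {x. f x \<noteq> 0 \<and> \<alpha> * fst x + \<beta> * snd x = \<gamma>}"
      by (rule rich_line_in_support[OF _ _ _ nz])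
        (use False nm p in \<open>simp_all add: p_def n_def m_def\<close>)
    then obtain \<alpha> \<beta> \<gamma> where "p - 2 + 2 \<le> card {x. f x \<noteq> 0 \<and> \<alpha> * fst x + \<beta> * snd x = \<gamma>}"
      by blast
    also have "\<dots> \<le> n" unfolding n_def by (intro card_mono) (rule finite, blast)
    finally have "p \<le> n" using p by simp
    then have False using False nm by (simp add: n_def m_def)
    then show ?thesis ..
  next
    case True
    then have k: "k \<ge> 1" using p by (simp add: k_def div_greater_zero_iff Suc_le_eq)
    have n: "n + 11 * k < 2 * p" using small True by (simp add: n_def m_def k_def p_def)
    have "\<exists>\<alpha> \<beta> \<gamma>. (\<alpha> \<noteq> 0 \<or> \<beta> \<noteq> 0) \<and>
        (p - 1 - k) + 2 \<le> card {x. f x \<noteq> 0 \<and> \<alpha> * fst x + \<beta> * snd x = \<gamma>}"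
    proof (rule rich_line_in_support[OF _ _ _ nz])
      have "p - (p - 1 - k) = k + 1" using n k by simp
      then show "card {u. dft f u \<noteq> 0} < CARD('p) * (CARD('p) - (p - 1 - k))"
        using m_lt by (simp add: p_def m_def)
    qed (use n k in \<open>simp_all add: p_def n_def\<close>)
    then obtain \<alpha> \<beta> \<gamma> where ab: "\<alpha> \<noteq> 0 \<or> \<beta> \<noteq> 0"
      and line1: "p - 1 - k + 2 \<le> card {x. f x \<noteq> 0 \<and> \<alpha> * fst x + \<beta> * snd x = \<gamma>}"
      by blast
    show ?thesis
    proof (cases "\<forall>x. f x \<noteq> 0 \<longrightarrow> \<alpha> * fst x + \<beta> * snd x = \<gamma>")
      case True
      with ab show ?thesis by blast
    next
      case False
      \<comment> \<open>This factor vanishes exactly on the first line.\<close>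
      define g where "g x = f x * (add_char (dot (\<alpha>, \<beta>) x) - add_char \<gamma>)" for x
      have g: "g x \<noteq> 0 \<longleftrightarrow> f x \<noteq> 0 \<and> \<alpha> * fst x + \<beta> * snd x \<noteq> \<gamma>" for x
        using inj_eq[OF add_char_inj, of "\<alpha> * fst x + \<beta> * snd x" \<gamma>]
        by (simp add: g_def dot_def)
      have "\<exists>\<alpha> \<beta> \<gamma>. (\<alpha> \<noteq> 0 \<or> \<beta> \<noteq> 0) \<and>
          (p - 2 - 2 * k) + 2 \<le> card {x. g x \<noteq> 0 \<and> \<alpha> * fst x + \<beta> * snd x = \<gamma>}"
      proof (rule rich_line_in_support)
        have "card {u. dft g u \<noteq> 0} \<le> 2 * m"
          unfolding g_def m_def by (rule card_dft_supp_shift_combination)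
        also have "\<dots> < p * (2 * k + 2)" using m_lt by simp
        also have "2 * k + 2 = p - (p - 2 - 2 * k)" using n k by simp
        finally show "card {u. dft g u \<noteq> 0} < CARD('p) * (CARD('p) - (p - 2 - 2 * k))"
          by (simp add: p_def)
        have "card {x. g x \<noteq> 0} \<le> n" unfolding n_def g by (intro card_mono) (rule finite, blast)
        then show "card {x. g x \<noteq> 0} \<le> 2 * (p - 2 - 2 * k) + 1" using n k by simp
        show "\<exists>x. g x \<noteq> 0" using False unfolding g by blast
        show "p - 2 - 2 * k + 2 \<le> CARD('p)" using n k by (simp add: p_def)
      qed
      then obtain \<alpha>' \<beta>' \<gamma>' where
        line2: "p - 2 - 2 * k + 2 \<le> card {x. g x \<noteq> 0 \<and> \<alpha>' * fst x + \<beta>' * snd x = \<gamma>'}"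
        by blast
      have "card {x. f x \<noteq> 0 \<and> \<alpha> * fst x + \<beta> * snd x = \<gamma>}
          + card {x. g x \<noteq> 0 \<and> \<alpha>' * fst x + \<beta>' * snd x = \<gamma>'}
          = card ({x. f x \<noteq> 0 \<and> \<alpha> * fst x + \<beta> * snd x = \<gamma>}
            \<union> {x. g x \<noteq> 0 \<and> \<alpha>' * fst x + \<beta>' * snd x = \<gamma>'})"
        unfolding g by (rule card_Un_disjoint[symmetric]) (rule finite, rule finite, blast)
      also have "\<dots> \<le> n" unfolding n_def g by (intro card_mono) (rule finite, blast)
      finally have "p - 1 - k + 2 + (p - 2 - 2 * k + 2) \<le> n" using line1 line2 by linarith
      then have False using n k by simp
      then show ?thesis ..
    qed
  qed
qed

text \<open>The constant \<open>11\<close> comes from \<open>2 * sqrt p \<ge> 11\<close>, which holds for \<open>p \<ge> 31\<close>.\<close>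

lemma size_bound_of_epsilon:
  fixes p n m :: nat
  assumes "31 \<le> p" "0 < \<epsilon>" "real n < 2 * (1 - \<epsilon>) * real p" "real m < \<epsilon> * real p powr (3 / 2)"
  shows "n + 11 * (m div p) < 2 * p"
proof -
  define s where "s = sqrt (real p)"
  have s2: "s * s = real p" by (simp add: s_def)
  have "sqrt (5.5 ^ 2) \<le> s" unfolding s_def using assms(1) by (intro real_sqrt_le_mono) (simp add: power2_eq_square)
  then have s: "5.5 \<le> s" by simp
  have "real p powr (3 / 2) = real p powr 1 * real p powr (1 / 2)"
    using powr_add[of "real p" 1 "1 / 2"] by simp
  also have "\<dots> = real p * s" using assms(1) by (simp add: s_def powr_half_sqrt)
  finally have "real m < real p * (\<epsilon> * s)" using assms(4) by (simp add: mult_ac)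
  moreover have "real p * real (m div p) \<le> real m"
    by (metis of_nat_mult of_nat_le_iff times_div_less_eq_dividend)
  ultimately have "real p * real (m div p) < real p * (\<epsilon> * s)" by linarith
  then have "real (m div p) < \<epsilon> * s" using assms(1) by simp
  then have "11 * real (m div p) < 11 * (\<epsilon> * s)" by simp
  also have "\<dots> \<le> 2 * s * (\<epsilon> * s)" using s assms(2) by (intro mult_right_mono) auto
  also have "\<dots> = 2 * \<epsilon> * real p" by (simp flip: s2)
  finally have "real n + 11 * real (m div p) < 2 * real p" using assms(3) by (simp add: algebra_simps)
  then show ?thesis by (simp flip: of_nat_add of_nat_mult add: of_nat_less_iff)
qed

section \<open>Duality\<close>

lemma dft_eq_0: "(\<And>x. f x = 0) \<Longrightarrow> dft f u = 0"
  by (simp add: dft_def)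

lemma sum_add_char_dot:
  fixes x :: "'p::prime_card mod_ring \<times> 'p mod_ring"
  assumes "x \<noteq> 0"
  shows "(\<Sum>u\<in>UNIV. add_char (dot u x)) = 0"
proof -
  obtain v where v: "dot v x \<noteq> 0" using dot_nondegenerate[of x] assms by blast
  have "(\<Sum>u\<in>UNIV. add_char (dot u x)) = (\<Sum>u\<in>UNIV. add_char (dot (u + v) x))"
    by (rule sum.reindex_bij_witness[of _ "\<lambda>u. u + v" "\<lambda>u. u - v"]) auto
  also have "\<dots> = add_char (dot v x) * (\<Sum>u\<in>UNIV. add_char (dot u x))"
    by (simp add: dot_add_left add_char_add sum_distrib_left mult.commute)
  finally have "(add_char (dot v x) - 1) * (\<Sum>u\<in>UNIV. add_char (dot u x)) = 0"
    by (simp add: algebra_simps)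
  moreover have "add_char (dot v x) \<noteq> 1"
    using v injD[OF add_char_inj, of "dot v x" 0] by auto
  ultimately show ?thesis by simp
qed

text \<open>Fourier inversion.\<close>

lemma dft_dft:
  fixes f :: "'p::prime_card mod_ring \<times> 'p mod_ring \<Rightarrow> complex"
  shows "dft (dft f) v = of_nat CARD('p mod_ring \<times> 'p mod_ring) * f (- v)"
proof -
  have "dft (dft f) v = (\<Sum>u\<in>UNIV. \<Sum>x\<in>UNIV. f x * add_char (dot u (x + v)))"
    by (simp add: dft_def[of "dft f"] dot_add_right add_char_add dot_commute[of v] mult.assoc
      sum_distrib_right) (simp add: dft_def sum_distrib_right mult.assoc)
  also have "\<dots> = (\<Sum>x\<in>UNIV. f x * (\<Sum>u\<in>UNIV. add_char (dot u (x + v))))"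
    by (subst sum.swap) (simp add: sum_distrib_left)
  also have "\<dots> = (\<Sum>x\<in>{- v}. f x * (\<Sum>u\<in>UNIV. add_char (dot u (x + v))))"
    by (intro sum.mono_neutral_right ballI) (simp_all add: sum_add_char_dot eq_neg_iff_add_eq_0)
  also have "\<dots> = of_nat CARD('p mod_ring \<times> 'p mod_ring) * f (- v)"
    by (simp add: dot_def)
  finally show ?thesis .
qed

lemma card_neg_supp: "card {x :: 'a::ab_group_add. P (- x)} = card {x. P x}"
  by (rule bij_betw_same_card[of uminus], rule bij_betwI[of _ _ _ uminus]) auto

text \<open>The character of the plane with frequency \<open>u\<close>.\<close>

definition plane_char :: "'p::prime_card mod_ring \<times> 'p mod_ring \<Rightarrow> 'p mod_ring \<times> 'p mod_ring \<Rightarrow> complex" where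
  "plane_char u x = add_char (dot u x)"

lemma cnj_add_char: "cnj (add_char a) = add_char (- a :: 'p::prime_card mod_ring)"
proof -
  have norm: "norm (add_char a) = 1" by (simp add: add_char_def zeta_def norm_power)
  have "add_char a * add_char (- a) = 1" by (simp flip: add_char_add)
  moreover have "add_char a * cnj (add_char a) = 1"
    using norm complex_norm_square[of "add_char a"] by simp
  ultimately show ?thesis by (metis add_char_nonzero mult_left_cancel)
qed

lemma fourier_plane_char:
  fixes f :: "'p::prime_card mod_ring \<times> 'p mod_ring \<Rightarrow> complex"
  shows "fourier f (plane_char u) = dft f (- u) / of_nat CARD('p mod_ring \<times> 'p mod_ring)"
proof -
  have "- dot u x = dot (- u) x" for x :: "'p mod_ring \<times> 'p mod_ring"
    by (simp add: dot_def)
  then show ?thesis by (simp add: fourier_def dft_def plane_char_def cnj_add_char)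
qed

lemma inj_plane_char: "inj (plane_char :: 'p::prime_card mod_ring \<times> 'p mod_ring \<Rightarrow> _)"
proof (rule injI)
  fix u v :: "'p mod_ring \<times> 'p mod_ring" assume "plane_char u = plane_char v"
  then have eq: "dot u x = dot v x" for x
    using injD[OF add_char_inj] by (metis plane_char_def)
  have "dot x (u - v) = 0" for x
    using eq[of x] by (simp add: dot_def algebra_simps)
  then show "u = v" using dot_nondegenerate[of "u - v"] by simp
qed

text \<open>A character is determined by its values at \<open>(1, 0)\<close> and \<open>(0, 1)\<close>, which are \<open>p\<close>-th roots of unity.\<close>

lemma characters_eq_range_plane_char:
  "characters = range (plane_char :: 'p::prime_card mod_ring \<times> 'p mod_ring \<Rightarrow> _)"
proof (intro equalityI subsetI)
  fix \<chi> :: "'p mod_ring \<times> 'p mod_ring \<Rightarrow> complex"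
  assume "\<chi> \<in> characters"
  then have nz: "\<And>x. \<chi> x \<noteq> 0" and mult: "\<And>x y. \<chi> (x + y) = \<chi> x * \<chi> y"
    by (auto simp: characters_def)
  have zero: "\<chi> 0 = 1" using mult[of 0 0] nz[of 0] by simp
  have pow1: "\<chi> (of_nat n, 0) = \<chi> (1, 0) ^ n" for n
  proof (induction n)
    case 0
    then show ?case using zero by (simp add: zero_prod_def)
  next
    case (Suc n)
    then show ?case using mult[of "(1, 0)" "(of_nat n, 0)"] by simp
  qed
  have pow2: "\<chi> (0, of_nat n) = \<chi> (0, 1) ^ n" for n
  proof (induction n)
    case 0
    then show ?case using zero by (simp add: zero_prod_def)
  next
    case (Suc n)
    then show ?case using mult[of "(0, 1)" "(0, of_nat n)"] by simp
  qed
  have "\<chi> (1, 0) ^ CARD('p) = 1" "\<chi> (0, 1) ^ CARD('p) = 1"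
    using pow1[of "CARD('p)"] pow2[of "CARD('p)"] zero by (simp_all add: zero_prod_def)
  then obtain a b :: "'p mod_ring" where ab: "\<chi> (1, 0) = add_char a" "\<chi> (0, 1) = add_char b"
    using add_char_surj by metis
  have add_char_pow: "add_char c ^ n = add_char (c * of_nat n)" for c :: "'p mod_ring" and n
    by (induction n) (simp_all add: algebra_simps add_char_add)
  have "\<chi> x = plane_char (a, b) x" for x
  proof -
    obtain i j where x: "x = (of_nat i, of_nat j)"
      by (metis of_nat_nat_to_int_mod_ring prod.collapse)
    have "\<chi> x = \<chi> (of_nat i, 0) * \<chi> (0, of_nat j)" using mult[of "(of_nat i, 0)" "(0, of_nat j)"] x by simp
    also have "\<dots> = plane_char (a, b) x"
      by (simp add: pow1 pow2 ab add_char_pow plane_char_def dot_def x add_char_add)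
    finally show ?thesis .
  qed
  then show "\<chi> \<in> range plane_char" by blast
next
  fix \<chi> :: "'p mod_ring \<times> 'p mod_ring \<Rightarrow> complex"
  assume "\<chi> \<in> range plane_char"
  then obtain u where "\<chi> = plane_char u" by blast
  then show "\<chi> \<in> characters"
    by (simp add: characters_def plane_char_def dot_add_right add_char_add del: split_paired_All)
qed

section \<open>Cosets of lines\<close>

lemma plane_char_iso: "plane_char \<in> iso additive_group (dual_group :: ('p::prime_card mod_ring \<times> 'p mod_ring \<Rightarrow> complex) monoid)"
proof -
  have "plane_char \<in> hom additive_group (dual_group :: ('p mod_ring \<times> 'p mod_ring \<Rightarrow> complex) monoid)"
    by (rule homI) (auto simp: additive_group_def dual_group_def characters_eq_range_plane_char
        plane_char_def dot_add_left add_char_add fun_eq_iff)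
  then show ?thesis
    using inj_plane_char characters_eq_range_plane_char[symmetric]
    by (simp add: iso_def bij_betw_def additive_group_def dual_group_def)
qed

lemma in_proper_coset_iso:
  assumes "group G" "group G'" "\<phi> \<in> iso G G'" "in_proper_coset G A"
  shows "in_proper_coset G' (\<phi> ` A)"
proof -
  interpret group_hom G G' \<phi>
    using assms by (simp add: group_hom_def group_hom_axioms_def iso_def)
  have inj: "inj_on \<phi> (carrier G)" and surj: "\<phi> ` carrier G = carrier G'"
    using assms(3) by (auto simp: iso_def bij_betw_def)
  obtain H a where H: "subgroup H G" "H \<noteq> {\<one>\<^bsub>G\<^esub>}" "H \<noteq> carrier G"
    and a: "a \<in> carrier G" "A \<subseteq> H #>\<^bsub>G\<^esub> a"
    using assms(4) by (auto simp: in_proper_coset_def RCOSETS_def)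
  have sub: "H \<subseteq> carrier G" by (rule subgroup.subset[OF H(1)])
  have ne: "\<phi> ` H \<noteq> \<phi> ` {\<one>\<^bsub>G\<^esub>}" "\<phi> ` H \<noteq> \<phi> ` carrier G"
    using inj_on_image_eq_iff[OF inj sub, of "{\<one>\<^bsub>G\<^esub>}"]
      inj_on_image_eq_iff[OF inj sub, of "carrier G"] H(2,3) by blast+
  have "\<phi> ` H \<noteq> {\<one>\<^bsub>G'\<^esub>}" using ne(1) by simp
  moreover have "\<phi> ` H \<noteq> carrier G'" using ne(2) surj by simp
  moreover have "subgroup (\<phi> ` H) G'" by (rule subgroup_img_is_subgroup[OF H(1)])
  moreover have "\<phi> ` A \<subseteq> (\<phi> ` H) #>\<^bsub>G'\<^esub> \<phi> a"
    using a sub unfolding r_coset_def by fastforce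
  moreover have "\<phi> a \<in> carrier G'" using a(1) by simp
  ultimately show ?thesis
    unfolding in_proper_coset_def RCOSETS_def by blast
qed

lemma in_proper_coset_of_line:
  fixes A :: "('p::prime_card mod_ring \<times> 'p mod_ring) set"
  assumes "\<alpha> \<noteq> 0 \<or> \<beta> \<noteq> 0" "\<And>x. x \<in> A \<Longrightarrow> \<alpha> * fst x + \<beta> * snd x = \<gamma>" "A \<noteq> {}"
  shows "in_proper_coset additive_group A"
proof -
  interpret G: comm_group "additive_group :: ('p mod_ring \<times> 'p mod_ring) monoid"
    by (rule comm_group_additive_group)
  define H where "H = {x :: 'p mod_ring \<times> 'p mod_ring. \<alpha> * fst x + \<beta> * snd x = 0}"
  obtain a where a: "a \<in> A" using assms(3) by blast
  have "subgroup H additive_group"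
  proof (rule G.subgroupI)
    show "H \<noteq> {}" by (auto simp: H_def intro!: exI[of _ 0])
    fix x assume x: "x \<in> H"
    have "inv\<^bsub>additive_group\<^esub> x = - x"
      by (rule G.inv_equality) (simp_all add: additive_group_def)
    moreover have "\<alpha> * fst (- x) + \<beta> * snd (- x) = - (\<alpha> * fst x + \<beta> * snd x)" by simp
    ultimately show "inv\<^bsub>additive_group\<^esub> x \<in> H" using x
      by (simp only: H_def mem_Collect_eq minus_zero)
  qed (auto simp: H_def additive_group_def algebra_simps)
  moreover have "(\<beta>, - \<alpha>) \<in> H" "(\<beta>, - \<alpha>) \<noteq> 0"
    using assms(1) by (auto simp: H_def zero_prod_def)
  then have "H \<noteq> {\<one>\<^bsub>additive_group\<^esub>}" by (auto simp: additive_group_def)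
  moreover have "(1, 0) \<notin> H \<or> (0, 1) \<notin> H" using assms(1) by (simp add: H_def)
  then have "H \<noteq> carrier additive_group" by (auto simp: additive_group_def)
  moreover have "A \<subseteq> H #>\<^bsub>additive_group\<^esub> a"
  proof
    fix x assume "x \<in> A"
    then have "x - a \<in> H"
      using assms(2)[of x] assms(2)[OF a] by (simp add: H_def algebra_simps)
    then have "(x - a) \<otimes>\<^bsub>additive_group\<^esub> a \<in> H #>\<^bsub>additive_group\<^esub> a"
      unfolding r_coset_def by blast
    then show "x \<in> H #>\<^bsub>additive_group\<^esub> a" by (simp add: additive_group_def)
  qed
  moreover have "a \<in> carrier additive_group" by (simp add: additive_group_def)
  ultimately show ?thesis unfolding in_proper_coset_def RCOSETS_def by blast
qed

theorem theorem4:
  fixes f :: "'p::prime_card mod_ring \<times> 'p mod_ring \<Rightarrow> complex"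
    and \<epsilon> :: real
    and S :: "('p mod_ring \<times> 'p mod_ring) set"
    and X :: "('p mod_ring \<times> 'p mod_ring \<Rightarrow> complex) set"
  assumes "CARD('p) \<ge> 31"
    and "\<exists>x. f x \<noteq> 0"
    and "S = supp_on UNIV f"
    and "X = supp_on characters (fourier f)"
    and "0 < \<epsilon>" and "\<epsilon> < 1"
  shows "real (min (card S) (card X)) \<ge> 2 * (1 - \<epsilon>) * real CARD('p)
    \<or> real (max (card S) (card X)) \<ge> \<epsilon> * real CARD('p) powr (3 / 2)
    \<or> ((card S \<le> card X \<longrightarrow> in_proper_coset additive_group S) \<and>
       (card X \<le> card S \<longrightarrow> in_proper_coset dual_group X))"
proof -
  let ?q = "of_nat CARD('p mod_ring \<times> 'p mod_ring) :: complex"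
  have S: "S = {x. f x \<noteq> 0}" by (simp add: assms(3) supp_on_def)
  have "X = plane_char ` {u. dft f (- u) \<noteq> 0}"
    unfolding assms(4) supp_on_def characters_eq_range_plane_char by (auto simp: fourier_plane_char)
  note X = this
  have card_X: "card X = card {u. dft f u \<noteq> 0}"
    unfolding X card_neg_supp[of "\<lambda>u. dft f u \<noteq> 0", symmetric]
    by (rule card_image) (rule inj_on_subset[OF inj_plane_char], simp)
  have "{v. dft (dft f) v \<noteq> 0} = {v. f (- v) \<noteq> 0}"
    by (simp add: dft_dft del: card_prod of_nat_mult)
  then have card_S: "card {v. dft (dft f) v \<noteq> 0} = card S"
    by (simp add: S card_neg_supp[of "\<lambda>x. f x \<noteq> 0"])
  have nz: "\<exists>u. dft f u \<noteq> 0"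
  proof (rule ccontr)
    assume "\<not> ?thesis"
    then have "dft f u = 0" for u by blast
    then have "dft (dft f) v = 0" for v by (rule dft_eq_0)
    then have "card S = 0" using card_S by simp
    then show False using assms(2) by (simp add: S)
  qed
  show ?thesis
  proof (rule ccontr)
    assume "\<not> ?thesis"
    then have min: "real (min (card S) (card X)) < 2 * (1 - \<epsilon>) * real CARD('p)"
      and max: "real (max (card S) (card X)) < \<epsilon> * real CARD('p) powr (3 / 2)"
      and no: "\<not> ((card S \<le> card X \<longrightarrow> in_proper_coset additive_group S) \<and>
        (card X \<le> card S \<longrightarrow> in_proper_coset dual_group X))" by auto
    have "in_proper_coset additive_group S" if le: "card S \<le> card X"
    proof -
      have "card S + 11 * (card X div CARD('p)) < 2 * CARD('p)"
        using min max le by (intro size_bound_of_epsilon[OF assms(1,5)]) simp_all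
      then obtain \<alpha> \<beta> \<gamma> where "\<alpha> \<noteq> 0 \<or> \<beta> \<noteq> 0" "\<forall>x. f x \<noteq> 0 \<longrightarrow> \<alpha> * fst x + \<beta> * snd x = \<gamma>"
        using small_support_on_line[OF assms(2)] le unfolding S card_X by blast
      then show ?thesis using assms(2) by (intro in_proper_coset_of_line) (auto simp: S)
    qed
    moreover have "in_proper_coset dual_group X" if le: "card X \<le> card S"
    proof -
      have "card X + 11 * (card S div CARD('p)) < 2 * CARD('p)"
        using min max le by (intro size_bound_of_epsilon[OF assms(1,5)]) simp_all
      then obtain \<alpha> \<beta> \<gamma> where line: "\<alpha> \<noteq> 0 \<or> \<beta> \<noteq> 0"
        "\<forall>u. dft f u \<noteq> 0 \<longrightarrow> \<alpha> * fst u + \<beta> * snd u = \<gamma>"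
        using small_support_on_line[OF nz] le unfolding card_S card_X by blast
      have "in_proper_coset additive_group {u. dft f (- u) \<noteq> 0}"
      proof (rule in_proper_coset_of_line[OF line(1)])
        fix u assume "u \<in> {u. dft f (- u) \<noteq> 0}"
        then have "\<alpha> * fst (- u) + \<beta> * snd (- u) = \<gamma>" using line(2) by blast
        moreover have "\<alpha> * fst (- u) + \<beta> * snd (- u) = - (\<alpha> * fst u + \<beta> * snd u)" by simp
        ultimately show "\<alpha> * fst u + \<beta> * snd u = - \<gamma>" by (metis minus_minus)
      next
        show "{u. dft f (- u) \<noteq> 0} \<noteq> {}" using nz by (metis (mono_tags) empty_iff mem_Collect_eq minus_minus)
      qed
      then show ?thesis
        unfolding X using plane_char_iso comm_group_additive_group comm_group_dual_group
        by (intro in_proper_coset_iso[of additive_group]) (auto simp: comm_group_def)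
    qed
    ultimately show False using no by blast
  qed
qed

end
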